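(* Let $A$ be a complex abelian variety. Consider the formula $$\begin{pmatrix}a&b\\c&d\end{pmatrix}\omega:=(c+d\omega)(a+b\omega)^{-1},\qquad \begin{pmatrix}a&b\\c&d\end{pmatrix}\in\mathrm U_{A,\mathbb Q}(\mathbb R),\ \ \omega\in NS_A(\mathbb C).$$ (a) This defines a well-defined action of $\mathrm U_{A,\mathbb Q}(\mathbb R)$ on $C_A$. (b) The action on $C_A^+$ (resp. on $C_A^-$) is transitive. (c) The stabilizer of a point in $C_A$ is a maximal compact subgroup of the Lie group $\mathrm U_{A,\mathbb Q}(\mathbb R)$.
   Context: Let $A=(V/\Gamma,J)$, where $\Gamma=H_1(A,\mathbb Z)$, $V=\Gamma\otimes\mathbb R$, $J$ the complex structure, and $\hat A=(V^*/\Gamma^*,\hat J)$, $(\hat Jw)(v)=w(-Jv)$, the dual abelian variety. The Néron–Severi group $NS_A$ is identified (by first Chern class) with the group of integral skew-symmetric forms $c$ on $\Gamma$ with $c_{\mathbb R}$ $J$-invariant, and with a subgroup of $\mathrm{Hom}(A,\hat A)$ via $c\mapsto(v\mapsto c(v,\cdot))$; $NS_A(\mathbb R)=NS_A\otimes\mathbb R$, $NS_A(\mathbb C)=NS_A\otimes\mathbb C\subset\mathrm{Hom}(A,\hat A)\otimes\mathbb C$, and products in the formula are compositions of maps. $C_A^a\subset NS_A(\mathbb R)$ is the ample cone (the $\mathbb R^+$-linear combinations of ample classes in $NS_A$), $C_A^{\pm}=NS_A(\mathbb R)\pm iC_A^a\subset NS_A(\mathbb C)$, $C_A=C_A^+\sqcup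 C_A^-$. $\mathrm U_{A,\mathbb Q}$ is the $\mathbb Q$-algebraic group of all invertible $g=\begin{pmatrix}a&b\\c&d\end{pmatrix}\in\mathrm{End}(A\times\hat A)\otimes\mathbb Q$ (with $a\in\mathrm{End}(A)\otimes\mathbb Q$, $b\in\mathrm{Hom}(\hat A,A)\otimes\mathbb Q$, $c\in\mathrm{Hom}(A,\hat A)\otimes\mathbb Q$, $d\in\mathrm{End}(\hat A)\otimes\mathbb Q$) such that $g^{-1}=\begin{pmatrix}\hat d&-\hat b\\-\hat c&\hat a\end{pmatrix}$, where $\hat{}$ is the dual morphism ($A$ identified with its double dual via the Poincaré bundles), so that as linear maps $\hat a=a^t$, $\hat d=d^t$, $\hat b=-b^t$, $\hat c=-c^t$. $\mathrm U_{A,\mathbb Q}(\mathbb R)$ is its group of real points. *)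

theory Defs
  imports "HOL-Analysis.Analysis" "HOL-Algebra.Group_Action"
begin

text \<open>
  A complex torus \<open>(V/\<Gamma>, J)\<close> is written in a fixed \<open>\<int>\<close>-basis of \<open>\<Gamma> = H\<^sub>1(A,\<int>)\<close>:
  \<open>\<Gamma> = \<int>\<^sup>n\<close>, \<open>V = \<Gamma> \<otimes> \<real> = \<real>\<^sup>n\<close>, and \<open>J\<close> is an arbitrary real matrix squaring to \<open>-1\<close>.
  The dual \<open>(V\<^sup>*, \<Gamma>\<^sup>*)\<close> is written in the dual basis, so it is again \<open>(\<real>\<^sup>n, \<int>\<^sup>n)\<close> with evaluation
  pairing \<open>w \<bullet> v\<close>, and the transpose of a linear map is the transpose of its matrix.
\<close>

definition lattice_pts :: "(real ^ 'n) set" where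
  "lattice_pts = {v. \<forall>i. v $ i \<in> \<int>}"

definition complex_structure :: "real ^ 'n ^ 'n \<Rightarrow> bool" where
  "complex_structure J \<longleftrightarrow> J ** J = - mat 1"

text \<open>\<open>(\<hat>J w)(v) = w(-J v)\<close>.\<close>

definition dual_structure :: "real ^ 'n ^ 'n \<Rightarrow> real ^ 'n ^ 'n" where
  "dual_structure J = - transpose J"

definition hom_tori :: "real ^ 'n ^ 'n \<Rightarrow> real ^ 'm ^ 'm \<Rightarrow> (real ^ 'n ^ 'm) set" where
  "hom_tori J1 J2 = {f. (\<forall>v\<in>lattice_pts. f *v v \<in> lattice_pts) \<and> f ** J1 = J2 ** f}"

text \<open>
  \<open>Hom \<otimes> \<real>\<close>. As \<open>\<Gamma>\<close> spans \<open>V\<close> freely, \<open>Hom \<otimes> \<real>\<close> injects into the real matrices, with image the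
  real span of \<open>Hom\<close> (in general smaller than the space of all matrices intertwining the
  complex structures).
\<close>

definition hom_real :: "real ^ 'n ^ 'n \<Rightarrow> real ^ 'm ^ 'm \<Rightarrow> (real ^ 'n ^ 'm) set" where
  "hom_real J1 J2 = span (hom_tori J1 J2)"

text \<open>The bilinear form \<open>c\<close> on \<open>V\<close> belonging to the map \<open>V \<rightarrow> V\<^sup>*\<close>, \<open>v \<mapsto> c(v, \<cdot>)\<close>, with matrix \<open>C\<close>.\<close>

definition form :: "real ^ 'n ^ 'n \<Rightarrow> real ^ 'n \<Rightarrow> real ^ 'n \<Rightarrow> real" where
  "form C v w = (C *v v) \<bullet> w"

definition NS :: "real ^ 'n ^ 'n \<Rightarrow> (real ^ 'n ^ 'n) set" where
  "NS J = {C. (\<forall>v\<in>lattice_pts. \<forall>w\<in>lattice_pts. form C v w \<in> \<int>)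
            \<and> (\<forall>v w. form C v w = - form C w v)
            \<and> (\<forall>v w. form C (J *v v) (J *v w) = form C v w)}"

definition NS_real :: "real ^ 'n ^ 'n \<Rightarrow> (real ^ 'n ^ 'n) set" where
  "NS_real J = span (NS J)"

text \<open>
  A class on a complex torus is ample iff the associated Hermitian form is positive definite. The
  sign below is that of the topological first Chern class (positive degree on elliptic curves
  oriented by \<open>(v, J v)\<close>). With the other common convention, \<open>c(J v, v) > 0\<close>, the sets
  \<open>C_plus\<close> and \<open>C_minus\<close> below are exchanged.
\<close>

definition ample_classes :: "real ^ 'n ^ 'n \<Rightarrow> (real ^ 'n ^ 'n) set" where
  "ample_classes J = {C \<in> NS J. \<forall>v. v \<noteq> 0 \<longrightarrow> form C v (J *v v) > 0}"

text \<open>Nonempty combinations with strictly positive coefficients, so that \<open>0\<close> is excluded.\<close>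

definition ample_cone :: "real ^ 'n ^ 'n \<Rightarrow> (real ^ 'n ^ 'n) set" where
  "ample_cone J = {\<Sum>C\<in>S. t C *\<^sub>R C | S t.
     finite S \<and> S \<noteq> {} \<and> S \<subseteq> ample_classes J \<and> (\<forall>C\<in>S. t C > 0)}"

definition abelian_variety :: "real ^ 'n ^ 'n \<Rightarrow> bool" where
  "abelian_variety J \<longleftrightarrow> complex_structure J \<and> ample_classes J \<noteq> {}"

definition cmat :: "real ^ 'n ^ 'm \<Rightarrow> complex ^ 'n ^ 'm" where
  "cmat M = map_matrix complex_of_real M"

text \<open>\<open>M + i N\<close>; the elements of \<open>NS \<otimes> \<complex>\<close> are those with \<open>M\<close> and \<open>N\<close> in \<open>NS \<otimes> \<real>\<close>.\<close>

definition complex_mat :: "real ^ 'n ^ 'm \<Rightarrow> real ^ 'n ^ 'm \<Rightarrow> complex ^ 'n ^ 'm" where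
  "complex_mat M N = (\<chi> i j. Complex (M $ i $ j) (N $ i $ j))"

definition C_plus :: "real ^ 'n ^ 'n \<Rightarrow> (complex ^ 'n ^ 'n) set" where
  "C_plus J = {complex_mat M N | M N. M \<in> NS_real J \<and> N \<in> ample_cone J}"

definition C_minus :: "real ^ 'n ^ 'n \<Rightarrow> (complex ^ 'n ^ 'n) set" where
  "C_minus J = {complex_mat M (- N) | M N. M \<in> NS_real J \<and> N \<in> ample_cone J}"

definition C_both :: "real ^ 'n ^ 'n \<Rightarrow> (complex ^ 'n ^ 'n) set" where
  "C_both J = C_plus J \<union> C_minus J"

text \<open>Endomorphisms of \<open>V \<oplus> V\<^sup>*\<close>; \<open>Inl\<close> indexes \<open>V\<close> and \<open>Inr\<close> indexes \<open>V\<^sup>*\<close>.\<close>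

definition block ::
  "real ^ 'n ^ 'n \<Rightarrow> real ^ 'n ^ 'n \<Rightarrow> real ^ 'n ^ 'n \<Rightarrow> real ^ 'n ^ 'n \<Rightarrow> real ^ ('n::finite + 'n) ^ ('n::finite + 'n)" where
  "block a b c d = (\<chi> i j.
     case i of
       Inl k \<Rightarrow> (case j of Inl l \<Rightarrow> a $ k $ l | Inr l \<Rightarrow> b $ k $ l)
     | Inr k \<Rightarrow> (case j of Inl l \<Rightarrow> c $ k $ l | Inr l \<Rightarrow> d $ k $ l))"

definition block_a :: "real ^ ('n::finite + 'n) ^ ('n::finite + 'n) \<Rightarrow> real ^ 'n ^ 'n" where
  "block_a g = (\<chi> k l. g $ Inl k $ Inl l)"

definition block_b :: "real ^ ('n::finite + 'n) ^ ('n::finite + 'n) \<Rightarrow> real ^ 'n ^ 'n" where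
  "block_b g = (\<chi> k l. g $ Inl k $ Inr l)"

definition block_c :: "real ^ ('n::finite + 'n) ^ ('n::finite + 'n) \<Rightarrow> real ^ 'n ^ 'n" where
  "block_c g = (\<chi> k l. g $ Inr k $ Inl l)"

definition block_d :: "real ^ ('n::finite + 'n) ^ ('n::finite + 'n) \<Rightarrow> real ^ 'n ^ 'n" where
  "block_d g = (\<chi> k l. g $ Inr k $ Inr l)"

text \<open>
  Dual morphisms as linear maps. The double dual of \<open>A\<close> is identified with \<open>A\<close> through the
  Poincare bundles, which introduces a sign for morphisms between \<open>A\<close> and its dual.
\<close>

definition dual_end :: "real ^ 'n ^ 'n \<Rightarrow> real ^ 'n ^ 'n" where
  "dual_end a = transpose a"

definition dual_cross :: "real ^ 'n ^ 'n \<Rightarrow> real ^ 'n ^ 'n" where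
  "dual_cross b = - transpose b"

definition formal_inverse :: "real ^ ('n::finite + 'n) ^ ('n::finite + 'n) \<Rightarrow> real ^ ('n::finite + 'n) ^ ('n::finite + 'n)" where
  "formal_inverse g =
     block (dual_end (block_d g)) (- dual_cross (block_b g))
           (- dual_cross (block_c g)) (dual_end (block_a g))"

text \<open>
  The real points of \<open>U\<^sub>A\<close>. As a closed linear group its Lie group topology is the subspace topology
  of the space of matrices.
\<close>

definition U_group :: "real ^ 'n ^ 'n \<Rightarrow> (real ^ ('n::finite + 'n) ^ ('n::finite + 'n)) monoid" where
  "U_group J =
     \<lparr>carrier = {g. block_a g \<in> hom_real J J
                  \<and> block_b g \<in> hom_real (dual_structure J) J
                  \<and> block_c g \<in> hom_real J (dual_structure J)
                  \<and> block_d g \<in> hom_real (dual_structure J) (dual_structure J)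
                  \<and> g ** formal_inverse g = mat 1 \<and> formal_inverse g ** g = mat 1},
      mult = (**), one = mat 1\<rparr>"

definition act_denom ::
  "real ^ ('n::finite + 'n) ^ ('n::finite + 'n) \<Rightarrow> complex ^ 'n ^ 'n \<Rightarrow> complex ^ 'n ^ 'n" where
  "act_denom g \<omega> = cmat (block_a g) + cmat (block_b g) ** \<omega>"

definition act ::
  "real ^ ('n::finite + 'n) ^ ('n::finite + 'n) \<Rightarrow> complex ^ 'n ^ 'n \<Rightarrow> complex ^ 'n ^ 'n" where
  "act g \<omega> = (cmat (block_c g) + cmat (block_d g) ** \<omega>) ** matrix_inv (act_denom g \<omega>)"

definition compact_subgroup :: "('g::topological_space) set \<Rightarrow> ('g, 'z) monoid_scheme \<Rightarrow> bool" where
  "compact_subgroup K G \<longleftrightarrow> subgroup K G \<and> compact K"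

definition maximal_compact_subgroup ::
  "('g::topological_space) set \<Rightarrow> ('g, 'z) monoid_scheme \<Rightarrow> bool" where
  "maximal_compact_subgroup K G \<longleftrightarrow>
     compact_subgroup K G \<and> (\<forall>K'. compact_subgroup K' G \<and> K \<subseteq> K' \<longrightarrow> K' = K)"

end

theory Submission
  imports Defs
begin

text \<open>
  The formula is a linear fractional transformation: \<open>\<omega>\<close> stands for its graph
  \<open>{(v, \<omega> v)}\<close> in the complexification of \<open>V \<oplus> V\<^sup>*\<close>, and \<open>g\<close> carries the graph of \<open>\<omega>\<close> to
  the graph of \<open>g \<omega>\<close>. For \<open>\<omega> = M + i N\<close> with \<open>N\<close> invertible the complexification is the direct sum
  of the graphs of \<open>\<omega>\<close> and of its conjugate, so \<open>\<omega>\<close> is the same as a real operator \<open>I\<close> on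
  \<open>V \<oplus> V\<^sup>*\<close> with \<open>I\<^sup>2 = -1\<close>, namely the one with eigenvalue \<open>i\<close> on the graph of \<open>\<omega>\<close>. The
  action and its stabilizers are easier to see on the side of \<open>I\<close>.

  Write \<open>Q\<close> for the evaluation pairing on \<open>V \<oplus> V\<^sup>*\<close> and \<open>JJ\<close> for the complex structure of
  \<open>A \<times> \<hat>A\<close>. The group consists of the isometries of \<open>Q\<close> in \<open>End(A \<times> \<hat>A) \<otimes> \<real>\<close>; all of
  them commute with \<open>JJ\<close>. The points of the two half spaces correspond exactly to the elements \<open>I\<close> of the
  group with \<open>I\<^sup>2 = -1\<close> for which the symmetric form \<open>S(x, y) = Q(JJ I x, y)\<close> is positive,
  respectively negative, definite (\<open>graph_structure_in_structures\<close>, \<open>structures_cases\<close>). This description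
  is invariant under conjugation by the group, and \<open>\<omega> \<mapsto> g \<omega>\<close> becomes \<open>I \<mapsto> g I g\<^sup>-\<^sup>1\<close>
  (\<open>act_conjugates\<close>). That gives the action and the invertibility of \<open>a + b \<omega>\<close>.

  The stabilizer of \<open>\<omega>\<close> is the centralizer of \<open>I\<close>, equivalently the set of group elements that preserve
  the definite form \<open>S\<close>, so it is compact. It is maximal because it contains \<open>I\<close>, and conjugation by \<open>I\<close>
  turns the inverse of \<open>g\<close> into the adjoint of \<open>g\<close> for \<open>S\<close>: a compact subgroup containing the stabilizer
  is closed under adjoints, and a compact group of matrices that is closed under adjoints consists
  of isometries (\<open>bounded_selfadjoint_contraction\<close>, \<open>centralizer_maximal\<close>).

  For transitivity, lower triangular and block diagonal elements of the group reduce the question to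
  finding, for \<open>N\<close> and \<open>N'\<close> in the ample cone, some \<open>a\<close> in \<open>End(A) \<otimes> \<real>\<close> with \<open>N' = a\<^sup>t N a\<close>. This relation
  is an equivalence relation on the ample cone. Its classes are open, since elements of the algebra close to
  \<open>1\<close> that are symmetric for the Rosati involution have square roots (\<open>NS_real_square_root\<close>), and the cone
  is connected.

  Two facts tie this to the arithmetic definitions. The inverse of an invertible element of
  \<open>Hom \<otimes> \<real>\<close> lies again in \<open>Hom \<otimes> \<real>\<close> (\<open>hom_real_inverse\<close>), and the ample cone consists of all positive
  definite elements of \<open>NS \<otimes> \<real>\<close> (\<open>ample_cone_iff\<close>).
\<close>

section \<open>Matrices\<close>

lemma matrix_minus_left: "(- A) ** B = - (A ** B)" for A :: "'a::ring_1 ^ 'n ^ 'm"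
  by (simp add: vec_eq_iff matrix_matrix_mult_def sum_negf)

lemma matrix_minus_right: "A ** (- B) = - (A ** B)" for A :: "'a::ring_1 ^ 'n ^ 'm"
  by (simp add: vec_eq_iff matrix_matrix_mult_def sum_negf)

lemma matrix_add_rdistrib: "(A + B) ** C = A ** C + B ** C" for A :: "'a::ring_1 ^ 'n ^ 'm"
  by (simp add: vec_eq_iff matrix_matrix_mult_def sum.distrib distrib_right)

lemma matrix_diff_rdistrib: "(A - B) ** C = A ** C - B ** C" for A :: "'a::ring_1 ^ 'n ^ 'm"
  by (simp add: vec_eq_iff matrix_matrix_mult_def sum_subtractf left_diff_distrib)

lemma matrix_diff_ldistrib: "A ** (B - C) = A ** B - A ** C" for A :: "'a::ring_1 ^ 'n ^ 'm"
  by (simp add: vec_eq_iff matrix_matrix_mult_def sum_subtractf right_diff_distrib)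

lemma matrix_scaleR_left: "(r *\<^sub>R A) ** B = r *\<^sub>R (A ** B)" for A :: "real ^ 'n ^ 'm"
  by (simp add: vec_eq_iff matrix_matrix_mult_def sum_distrib_left mult.assoc)

lemma matrix_scaleR_right: "A ** (r *\<^sub>R B) = r *\<^sub>R (A ** B)" for A :: "real ^ 'n ^ 'm"
  by (simp add: vec_eq_iff matrix_matrix_mult_def sum_distrib_left mult.left_commute)

lemma matrix_zero_left: "0 ** B = (0 :: 'a::ring_1 ^ 'n ^ 'm)"
  by (simp add: vec_eq_iff matrix_matrix_mult_def)

lemma matrix_zero_right: "A ** 0 = (0 :: 'a::ring_1 ^ 'n ^ 'm)"
  by (simp add: vec_eq_iff matrix_matrix_mult_def)

text \<open>Matrix multiplication relates three different types, so it does not belong to a type class with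
  ring laws; these rules normalize sums of products, with products associated to the right.\<close>

lemmas matrix_ring =
  matrix_add_ldistrib matrix_add_rdistrib matrix_diff_ldistrib matrix_diff_rdistrib
  matrix_minus_left matrix_minus_right matrix_zero_left matrix_zero_right
  matrix_mul_assoc [symmetric]

lemma matrix_cancel:
  assumes "A ** B = (mat 1 :: 'a::semiring_1 ^ 'n ^ 'n)"
  shows "A ** (B ** C) = C"
  by (simp add: matrix_mul_assoc assms)

lemma transpose_add: "transpose (A + B) = transpose A + transpose B"
  by (simp add: vec_eq_iff transpose_def)

lemma transpose_diff: "transpose (A - B) = transpose A - transpose B"
  by (simp add: vec_eq_iff transpose_def)

lemma transpose_minus: "transpose (- A) = - transpose A"
  by (simp add: vec_eq_iff transpose_def)

lemma transpose_zero: "transpose 0 = 0"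
  by (simp add: vec_eq_iff transpose_def)

lemmas transpose_ring =
  transpose_add transpose_diff transpose_minus transpose_zero matrix_transpose_mul transpose_scalar

lemma bounded_bilinear_matrix_mult:
  "bounded_bilinear ((**) :: real ^ 'n ^ 'm \<Rightarrow> real ^ 'p ^ 'n \<Rightarrow> real ^ 'p ^ 'm)"
  by (simp add: bilinear_def linear_iff bilinear_conv_bounded_bilinear [symmetric]
      matrix_add_ldistrib matrix_add_rdistrib matrix_scaleR_left matrix_scaleR_right)

lemma inner_matrix_vector: "(A *v x) \<bullet> y = x \<bullet> (transpose A *v y)" for A :: "real ^ 'n ^ 'm"
  by (metis dot_lmul_matrix inner_commute transpose_matrix_vector)

lemma matrix_eq_iff_inner:
  "A = B \<longleftrightarrow> (\<forall>x y. (A *v x) \<bullet> y = (B *v x) \<bullet> y)" for A :: "real ^ 'n ^ 'm"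
  by (metis matrix_eq vector_eq_rdot)

lemma inner_matrix_axis: "(A *v axis j 1) \<bullet> axis i 1 = A $ i $ j" for A :: "real ^ 'n ^ 'm"
  by (simp add: matrix_vector_mult_basis inner_axis column_def)

section \<open>Homomorphisms of complex tori tensored with the reals\<close>

lemma preserves_lattice_iff:
  fixes f :: "real ^ 'n ^ 'm"
  shows "(\<forall>v\<in>lattice_pts. f *v v \<in> lattice_pts) \<longleftrightarrow> (\<forall>i j. f $ i $ j \<in> \<int>)"
proof safe
  fix i j assume *: "\<forall>v\<in>lattice_pts. f *v v \<in> lattice_pts"
  have "(axis j 1 :: real ^ 'n) \<in> lattice_pts"
    by (auto simp: lattice_pts_def axis_def)
  with * have "f *v axis j 1 \<in> lattice_pts" by blast
  then show "f $ i $ j \<in> \<int>"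
    by (simp add: matrix_vector_mult_basis column_def lattice_pts_def)
next
  fix v :: "real ^ 'n" assume "\<forall>i j. f $ i $ j \<in> \<int>" "v \<in> lattice_pts"
  then show "f *v v \<in> lattice_pts"
    by (auto simp: lattice_pts_def matrix_vector_mult_def intro!: Ints_sum Ints_mult)
qed

lemma hom_tori_iff:
  "f \<in> hom_tori J1 J2 \<longleftrightarrow> (\<forall>i j. f $ i $ j \<in> \<int>) \<and> f ** J1 = J2 ** f"
  unfolding hom_tori_def by (simp add: preserves_lattice_iff)

lemma subspace_hom_real: "subspace (hom_real J1 J2)"
  by (simp add: hom_real_def)

lemmas hom_real_ops =
  subspace_add [OF subspace_hom_real] subspace_diff [OF subspace_hom_real]
  subspace_neg [OF subspace_hom_real] subspace_mul [OF subspace_hom_real]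
  subspace_0 [OF subspace_hom_real]

lemma hom_tori_mult: "f \<in> hom_tori J2 J3 \<Longrightarrow> g \<in> hom_tori J1 J2 \<Longrightarrow> f ** g \<in> hom_tori J1 J3"
  by (simp add: hom_tori_def matrix_vector_mul_assoc [symmetric])
    (metis matrix_mul_assoc)

lemma hom_real_mult:
  assumes "f \<in> hom_real J2 J3" "g \<in> hom_real J1 J2"
  shows "f ** g \<in> hom_real J1 J3"
proof -
  interpret bounded_bilinear "(**) :: real ^ 'b ^ 'c \<Rightarrow> real ^ 'a ^ 'b \<Rightarrow> real ^ 'a ^ 'c"
    by (rule bounded_bilinear_matrix_mult)
  have 1: "f ** g \<in> hom_real J1 J3" if f: "f \<in> hom_tori J2 J3" and "g \<in> hom_real J1 J2" for f g
    using that(2) unfolding hom_real_def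
  proof (induction rule: span_induct)
    case base
    then show ?case
      by (auto simp: subspace_def matrix_add_ldistrib matrix_scaleR_right matrix_zero_right
          intro: span_add span_scale span_zero)
  next
    case (step g)
    then show ?case using f hom_tori_mult by (blast intro: span_base)
  qed
  show ?thesis using assms(1) unfolding hom_real_def
  proof (induction rule: span_induct)
    case base
    then show ?case
      by (auto simp: subspace_def matrix_add_rdistrib matrix_scaleR_left matrix_zero_left
          intro: span_add span_scale span_zero)
  next
    case (step f)
    then show ?case using 1 assms(2) hom_real_def by blast
  qed
qed

lemma hom_real_intertwines:
  assumes "f \<in> hom_real J1 J2"
  shows "f ** J1 = J2 ** f"
  using assms unfolding hom_real_def
proof (induction rule: span_induct)
  case base
  then show ?case
    by (auto simp: subspace_def matrix_ring matrix_scaleR_left matrix_scaleR_right)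
next
  case (step f)
  then show ?case by (simp add: hom_tori_def)
qed

lemma hom_real_one: "mat 1 \<in> hom_real J J"
  unfolding hom_real_def by (intro span_base) (auto simp: hom_tori_def)

lemma dual_dual_structure: "dual_structure (dual_structure J) = J"
  by (simp add: dual_structure_def transpose_minus)

lemma hom_real_transpose:
  assumes "f \<in> hom_real J1 J2"
  shows "transpose f \<in> hom_real (dual_structure J2) (dual_structure J1)"
  using assms unfolding hom_real_def
proof (induction rule: span_induct)
  case base
  then show ?case
    by (auto simp: subspace_def transpose_ring intro: span_add span_scale span_zero)
next
  case (step f)
  then have "transpose f \<in> hom_tori (dual_structure J2) (dual_structure J1)"
    by (simp add: hom_tori_iff dual_structure_def matrix_minus_left matrix_minus_right
        matrix_transpose_mul [symmetric]) (simp add: transpose_def)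
  then show ?case by (rule span_base)
qed

lemma matrix_inverse_commutes:
  fixes f :: "real ^ 'n ^ 'n"
  assumes "f ** J1 = J2 ** f" "f ** y = mat 1"
  shows "y ** J2 = J1 ** y"
proof -
  have "y ** f = mat 1" using assms(2) by (simp add: matrix_left_right_inverse)
  then have "y ** (f ** J1) ** y = J1 ** y" by (simp add: matrix_mul_assoc)
  moreover have "y ** (J2 ** f) ** y = y ** J2"
    using assms(2) by (simp add: matrix_mul_assoc [symmetric])
  ultimately show ?thesis using assms(1) by simp
qed

text \<open>By Cramer's rule, multiplication by the determinant clears the denominators of the inverse of an
  integral matrix, so an isogeny has an inverse in \<open>Hom \<otimes> \<rat>\<close>.\<close>

lemma hom_tori_inverse:
  fixes f :: "real ^ 'n ^ 'n"
  assumes f: "f \<in> hom_tori J1 J2" and inv: "f ** y = mat 1"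
  shows "y \<in> hom_real J2 J1"
proof -
  have int: "f $ i $ j \<in> \<int>" for i j using f by (simp add: hom_tori_iff)
  have det_int: "det A \<in> \<int>" if "\<And>i j. A $ i $ j \<in> \<int>" for A :: "real ^ 'n ^ 'n"
    unfolding det_def using that by (intro Ints_sum Ints_mult Ints_prod) (auto simp: sign_def)
  have "det f * det y = 1" by (metis det_I det_mul inv)
  then have d0: "det f \<noteq> 0" by auto
  have "det f * y $ i $ j \<in> \<int>" for i j
  proof -
    define b where "b = (axis j 1 :: real ^ 'n)"
    have "f *v (y *v b) = b" by (simp add: matrix_vector_mul_assoc inv)
    then have "(y *v b) $ i = det (\<chi> i' j'. if j' = i then b $ i' else f $ i' $ j') / det f"
      using cramer [OF d0] by simp
    moreover have "(y *v b) $ i = y $ i $ j"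
      by (simp add: b_def matrix_vector_mult_basis column_def)
    ultimately have "det f * y $ i $ j = det (\<chi> i' j'. if j' = i then b $ i' else f $ i' $ j')"
      using d0 by simp
    also have "\<dots> \<in> \<int>" using int by (intro det_int) (auto simp: b_def axis_def)
    finally show ?thesis .
  qed
  moreover have "y ** J2 = J1 ** y"
    by (rule matrix_inverse_commutes [OF _ inv]) (use f in \<open>simp add: hom_tori_iff\<close>)
  ultimately have "det f *\<^sub>R y \<in> hom_tori J2 J1"
    by (simp add: hom_tori_iff matrix_scaleR_left matrix_scaleR_right)
  then have "(1 / det f) *\<^sub>R det f *\<^sub>R y \<in> hom_real J2 J1"
    unfolding hom_real_def by (intro span_scale span_base)
  then show ?thesis using d0 by simp
qed

text \<open>A finite-dimensional algebra contains the inverses of its invertible elements, because left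
  multiplication by such an element is injective on it, hence surjective.\<close>

lemma hom_real_inverse_end:
  fixes x :: "real ^ 'n ^ 'n"
  assumes x: "x \<in> hom_real J J" and inv: "x ** y = mat 1"
  shows "y \<in> hom_real J J"
proof -
  have yx: "y ** x = mat 1" using inv by (simp add: matrix_left_right_inverse)
  interpret bounded_bilinear "(**) :: real ^ 'n ^ 'n \<Rightarrow> real ^ 'n ^ 'n \<Rightarrow> real ^ 'n ^ 'n"
    by (rule bounded_bilinear_matrix_mult)
  have lin: "linear ((**) x :: real ^ 'n ^ 'n \<Rightarrow> real ^ 'n ^ 'n)" by (rule bounded_linear.linear [OF bounded_linear_right])
  have inj: "inj_on ((**) x) S" for S :: "(real ^ 'n ^ 'n) set"
    by (intro inj_on_inverseI [of _ "(**) y"] matrix_cancel yx)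
  have sub: "(**) x ` hom_real J J \<subseteq> hom_real J J" using hom_real_mult [OF x] by auto
  have "(**) x ` hom_real J J = hom_real J J"
    by (intro subspace_dim_equal linear_subspace_image lin subspace_hom_real sub)
      (simp add: dim_image_eq [OF lin inj])
  then obtain z where "z \<in> hom_real J J" "mat 1 = x ** z"
    using hom_real_one [of J] by (metis imageE)
  then show ?thesis by (metis matrix_cancel matrix_mul_rid yx)
qed

text \<open>The given invertible \<open>h\<close> in the opposite direction turns \<open>f\<close> into the endomorphism \<open>h f\<close>.\<close>

lemma hom_real_inverse:
  fixes f :: "real ^ 'n ^ 'n"
  assumes f: "f \<in> hom_real J1 J2" and inv: "f ** y = mat 1"
    and h: "h \<in> hom_real J2 J1" "h ** k = mat 1"
  shows "y \<in> hom_real J2 J1"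
proof -
  have yf: "y ** f = mat 1" and kh: "k ** h = mat 1"
    using inv h by (simp_all add: matrix_left_right_inverse)
  have "(h ** f) ** (y ** k) = mat 1"
    by (simp add: matrix_mul_assoc [symmetric] matrix_cancel [OF inv] h)
  then have "y ** k \<in> hom_real J1 J1"
    using hom_real_inverse_end hom_real_mult h(1) f by blast
  then have "(y ** k) ** h \<in> hom_real J2 J1" using hom_real_mult h(1) by blast
  then show ?thesis by (simp add: matrix_mul_assoc [symmetric] kh)
qed

section \<open>The ample cone\<close>

definition positive_definite :: "real ^ 'n ^ 'n \<Rightarrow> bool" where
  "positive_definite B \<longleftrightarrow> (\<forall>v. v \<noteq> 0 \<longrightarrow> (B *v v) \<bullet> v > 0)"

text \<open>The constant is the minimum of the form on the compact unit sphere.\<close>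

lemma positive_definite_lower:
  fixes B :: "real ^ 'n ^ 'n"
  assumes "positive_definite B"
  obtains c where "c > 0" "\<And>v. c * (v \<bullet> v) \<le> (B *v v) \<bullet> v"
proof -
  have "continuous_on (sphere 0 1) (\<lambda>v. (B *v v) \<bullet> v)"
    by (intro continuous_intros linear_continuous_on_compose [OF continuous_on_id]) auto
  moreover have "(axis undefined 1 :: real ^ 'n) \<in> sphere 0 1" by simp
  ultimately obtain u where u: "u \<in> sphere 0 1"
      "\<And>v. v \<in> sphere 0 1 \<Longrightarrow> (B *v u) \<bullet> u \<le> (B *v v) \<bullet> v"
    using continuous_attains_inf [OF compact_sphere, of 0 1 "\<lambda>v. (B *v v) \<bullet> v"] by blast
  have "u \<noteq> 0" using u(1) by auto
  show ?thesis
  proof (rule that [of "(B *v u) \<bullet> u"])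
    show "0 < (B *v u) \<bullet> u" using assms \<open>u \<noteq> 0\<close> by (simp add: positive_definite_def)
    fix v :: "real ^ 'n"
    show "(B *v u) \<bullet> u * (v \<bullet> v) \<le> (B *v v) \<bullet> v"
    proof (cases "v = 0")
      case False
      define w where "w = (1 / norm v) *\<^sub>R v"
      have w: "v = norm v *\<^sub>R w" "w \<in> sphere 0 1" using False by (auto simp: w_def)
      have "(B *v v) \<bullet> v = (norm v)\<^sup>2 * ((B *v w) \<bullet> w)"
        by (subst (1 2) w(1)) (simp add: matrix_vector_mult_scaleR power2_eq_square)
      moreover have "(norm v)\<^sup>2 * ((B *v u) \<bullet> u) \<le> (norm v)\<^sup>2 * ((B *v w) \<bullet> w)"
        by (intro mult_left_mono u(2) w(2)) simp
      ultimately show ?thesis by (simp add: power2_norm_eq_inner mult.commute)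
    qed simp
  qed
qed

lemma quadratic_form_upper:
  fixes B :: "real ^ 'n ^ 'n"
  obtains K where "K > 0" "\<And>v. \<bar>(B *v v) \<bullet> v\<bar> \<le> K * (v \<bullet> v)"
proof -
  obtain K where K: "K > 0" "\<And>v. norm (B *v v) \<le> norm v * K"
    using bounded_linear.pos_bounded [OF matrix_vector_mul_bounded_linear [of B]] by blast
  have "\<bar>(B *v v) \<bullet> v\<bar> \<le> K * (v \<bullet> v)" for v
  proof -
    have "\<bar>(B *v v) \<bullet> v\<bar> \<le> norm (B *v v) * norm v" by (rule Cauchy_Schwarz_ineq2)
    also have "\<dots> \<le> (norm v * K) * norm v" by (intro mult_right_mono K) simp
    finally show ?thesis by (simp add: dot_square_norm power2_eq_square mult_ac)
  qed
  with K(1) that show ?thesis by blast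
qed

lemma positive_definite_perturb:
  fixes A B :: "real ^ 'n ^ 'n"
  assumes "positive_definite A"
  obtains e where "e > 0" "\<And>d. \<bar>d\<bar> \<le> e \<Longrightarrow> positive_definite (A + d *\<^sub>R B)"
proof -
  obtain c where c: "c > 0" "\<And>v. c * (v \<bullet> v) \<le> (A *v v) \<bullet> v"
    using positive_definite_lower [OF assms] by blast
  obtain K where K: "K > 0" "\<And>v. \<bar>(B *v v) \<bullet> v\<bar> \<le> K * (v \<bullet> v)"
    using quadratic_form_upper by blast
  have "positive_definite (A + d *\<^sub>R B)" if d: "\<bar>d\<bar> \<le> c / (2 * K)" for d
    unfolding positive_definite_def
  proof safe
    fix v :: "real ^ 'n" assume "v \<noteq> 0"
    then have pos: "0 < v \<bullet> v" by simp
    have "\<bar>d * ((B *v v) \<bullet> v)\<bar> \<le> c / (2 * K) * (K * (v \<bullet> v))"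
      unfolding abs_mult using d K c by (intro mult_mono) auto
    also have "\<dots> = c / 2 * (v \<bullet> v)" using K by simp
    finally have "\<bar>d * ((B *v v) \<bullet> v)\<bar> \<le> c / 2 * (v \<bullet> v)" .
    moreover have "c / 2 * (v \<bullet> v) < c * (v \<bullet> v)" using c pos by simp
    ultimately show "0 < ((A + d *\<^sub>R B) *v v) \<bullet> v"
      using c(2) [of v]
      by (simp add: matrix_vector_mult_add_rdistrib inner_add_left scaleR_matrix_vector_assoc [symmetric])
  qed
  then show ?thesis using that [of "c / (2 * K)"] c K by simp
qed

lemma positive_definite_inverse:
  fixes B :: "real ^ 'n ^ 'n"
  assumes "positive_definite (A ** B)"
  obtains B' where "B ** B' = mat 1" "B' ** B = mat 1"
proof -
  have "\<forall>v. B *v v = 0 \<longrightarrow> v = 0"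
  proof safe
    fix v assume "B *v v = 0"
    then have "(A ** B) *v v = 0" by (simp add: matrix_vector_mul_assoc [symmetric])
    then show "v = 0" using assms by (force simp: positive_definite_def)
  qed
  then obtain B' where "B' ** B = mat 1" using matrix_left_invertible_ker [of B] by blast
  then show ?thesis using that matrix_left_right_inverse by blast
qed

lemma matrix_vector_minus_left: "(- A) *v x = - (A *v x)" for A :: "'a::ring_1 ^ 'n ^ 'm"
  by (simp add: vec_eq_iff matrix_vector_mult_def sum_negf)

lemma form_eq: "form C (A *v v) (B *v w) = ((transpose B ** C ** A) *v v) \<bullet> w"
  by (simp add: form_def matrix_vector_mul_assoc [symmetric] inner_matrix_vector inner_commute
      del: transpose_matrix_vector)

lemma form_one: "form C v w = form C (mat 1 *v v) (mat 1 *v w)"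
  by simp

text \<open>Invariance of the form under \<open>J\<close> is the intertwining condition because \<open>J\<^sup>2 = -1\<close>.\<close>

lemma NS_iff:
  fixes J :: "real ^ 'n ^ 'n"
  assumes "complex_structure J"
  shows "C \<in> NS J \<longleftrightarrow> C \<in> hom_tori J (dual_structure J) \<and> transpose C = - C"
proof -
  have JJ: "J ** J = - mat 1" using assms by (simp add: complex_structure_def)
  then have JtJt: "transpose J ** transpose J = - mat 1"
    by (simp add: matrix_transpose_mul [symmetric] transpose_minus)
  have 1: "(\<forall>v\<in>lattice_pts. \<forall>w\<in>lattice_pts. form C v w \<in> \<int>) \<longleftrightarrow> (\<forall>i j. C $ i $ j \<in> \<int>)"
  proof safe
    fix i j assume *: "\<forall>v\<in>lattice_pts. \<forall>w\<in>lattice_pts. form C v w \<in> \<int>"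
    have "(axis k 1 :: real ^ 'n) \<in> lattice_pts" for k by (auto simp: lattice_pts_def axis_def)
    then have "form C (axis j 1) (axis i 1) \<in> \<int>" using * by blast
    then show "C $ i $ j \<in> \<int>" by (simp add: form_def inner_matrix_axis)
  next
    fix v w :: "real ^ 'n"
    assume "\<forall>i j. C $ i $ j \<in> \<int>" "v \<in> lattice_pts" "w \<in> lattice_pts"
    then have "C *v v \<in> lattice_pts" using preserves_lattice_iff by blast
    with \<open>w \<in> lattice_pts\<close> show "form C v w \<in> \<int>"
      by (auto simp: form_def lattice_pts_def inner_vec_def intro!: Ints_sum Ints_mult)
  qed
  have "(\<forall>v w. form C v w = - form C w v)
      \<longleftrightarrow> (\<forall>v w. ((- transpose C) *v v) \<bullet> w = (C *v v) \<bullet> w)"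
    unfolding form_def by (subst inner_matrix_vector [of "- transpose C"])
      (simp add: transpose_minus inner_commute matrix_vector_minus_left eq_commute)
  also have "\<dots> \<longleftrightarrow> transpose C = - C"
    unfolding matrix_eq_iff_inner [symmetric] by (metis minus_minus)
  finally have 2: "(\<forall>v w. form C v w = - form C w v) \<longleftrightarrow> transpose C = - C" .
  have "(\<forall>v w. form C (J *v v) (J *v w) = form C v w) \<longleftrightarrow> transpose J ** C ** J = C"
    by (subst (2) form_one, unfold form_eq matrix_eq_iff_inner) simp
  also have "\<dots> \<longleftrightarrow> C ** J = dual_structure J ** C"
  proof
    assume "transpose J ** C ** J = C"
    then have "transpose J ** (transpose J ** C ** J) = transpose J ** C" by simp
    moreover have "transpose J ** (transpose J ** C ** J) = - (C ** J)"
      by (simp add: matrix_mul_assoc JtJt matrix_minus_left)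
    ultimately show "C ** J = dual_structure J ** C"
      unfolding dual_structure_def matrix_minus_left by (metis minus_minus)
  next
    assume "C ** J = dual_structure J ** C"
    then show "transpose J ** C ** J = C"
      by (simp add: matrix_mul_assoc [symmetric] dual_structure_def matrix_ring)
        (simp add: matrix_mul_assoc JtJt matrix_minus_left)
  qed
  finally have 3: "(\<forall>v w. form C (J *v v) (J *v w) = form C v w)
      \<longleftrightarrow> C ** J = dual_structure J ** C" .
  show ?thesis unfolding NS_def by (simp only: mem_Collect_eq 1 2 3 hom_tori_iff) blast
qed

lemma subspace_NS_real: "subspace (NS_real J)"
  by (simp add: NS_real_def)

text \<open>A real combination of integral homomorphisms that happens to be skew is also a combination of
  integral skew ones: \<open>C \<mapsto> C - C\<^sup>t\<close> sends \<open>Hom(A, \<hat>A)\<close> to the Neron--Severi group and is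
  multiplication by \<open>2\<close> on skew matrices.\<close>

lemma NS_real_iff:
  fixes J :: "real ^ 'n ^ 'n"
  assumes J: "complex_structure J"
  shows "N \<in> NS_real J \<longleftrightarrow> N \<in> hom_real J (dual_structure J) \<and> transpose N = - N"
proof
  assume "N \<in> NS_real J"
  then show "N \<in> hom_real J (dual_structure J) \<and> transpose N = - N"
    unfolding NS_real_def
  proof (induction rule: span_induct)
    case base
    then show ?case
      by (auto simp: subspace_def hom_real_ops transpose_ring)
  next
    case (step N)
    then show ?case by (simp add: NS_iff [OF J] hom_real_def span_base)
  qed
next
  assume N: "N \<in> hom_real J (dual_structure J) \<and> transpose N = - N"
  have "C - transpose C \<in> NS_real J" if "C \<in> hom_real J (dual_structure J)" for C
    using that unfolding hom_real_def
  proof (induction rule: span_induct)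
    case base
    have 1: "x + y - transpose (x + y) = (x - transpose x) + (y - transpose y)" for x y :: "real ^ 'n ^ 'n"
      by (simp add: transpose_ring)
    have 2: "r *\<^sub>R x - transpose (r *\<^sub>R x) = r *\<^sub>R (x - transpose x)" for r and x :: "real ^ 'n ^ 'n"
      by (simp add: transpose_ring algebra_simps)
    show ?case
      by (auto simp only: subspace_def [of "Collect _"] mem_Collect_eq 1 2 transpose_zero diff_zero
          intro: subspace_0 [OF subspace_NS_real] subspace_add [OF subspace_NS_real]
            subspace_mul [OF subspace_NS_real])
  next
    case (step C)
    have C: "\<And>i j. C $ i $ j \<in> \<int>" "C ** J = - (transpose J ** C)"
      using step by (simp_all add: hom_tori_iff dual_structure_def matrix_minus_left)
    have "transpose (C ** J) = transpose (- (transpose J ** C))" by (simp only: C(2))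
    then have "transpose C ** J = - (transpose J ** transpose C)"
      by (simp add: transpose_ring)
    then have "C - transpose C \<in> hom_tori J (dual_structure J)"
      using C by (auto simp: hom_tori_iff dual_structure_def matrix_ring transpose_def [of C])
    then have "C - transpose C \<in> NS J" by (simp add: NS_iff [OF J] transpose_ring)
    then show ?case by (simp add: NS_real_def span_base)
  qed
  then have "N - transpose N \<in> NS_real J" using N by blast
  moreover have "N - transpose N = 2 *\<^sub>R N" using N by (simp add: scaleR_2)
  ultimately have "2 *\<^sub>R N \<in> NS_real J" by simp
  from subspace_mul [OF subspace_NS_real this, of "1 / 2"] show "N \<in> NS_real J" by simp
qed

text \<open>The quadratic form of this matrix is \<open>v \<mapsto> N(v, J v)\<close>, the real part of the Hermitian form attached
  to \<open>N\<close>.\<close>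

definition hermitian :: "real ^ 'n ^ 'n \<Rightarrow> real ^ 'n ^ 'n \<Rightarrow> real ^ 'n ^ 'n" where
  "hermitian J N = transpose J ** N"

lemma form_hermitian: "form N v (J *v v) = (hermitian J N *v v) \<bullet> v"
  using form_eq [of N "mat 1" v J v] by (simp add: hermitian_def)

lemma hermitian_linear: "linear (hermitian J)"
  unfolding hermitian_def
  by (intro linearI) (simp_all add: matrix_add_ldistrib matrix_scaleR_right)

lemma ample_classes_iff: "C \<in> ample_classes J \<longleftrightarrow> C \<in> NS J \<and> positive_definite (hermitian J C)"
  by (simp add: ample_classes_def form_hermitian positive_definite_def)

lemma quadratic_form_sum:
  fixes f :: "'a \<Rightarrow> real ^ 'n ^ 'n"
  shows "((\<Sum>x\<in>S. t x *\<^sub>R f x) *v v) \<bullet> v = (\<Sum>x\<in>S. t x * ((f x *v v) \<bullet> v))"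
  by (induction S rule: infinite_finite_induct)
    (simp_all add: matrix_vector_mult_add_rdistrib inner_add_left scaleR_matrix_vector_assoc [symmetric])

lemma ample_cone_scaleR:
  assumes "N \<in> ample_cone J" "r > 0"
  shows "r *\<^sub>R N \<in> ample_cone J"
proof -
  obtain S t where S: "finite S" "S \<noteq> {}" "S \<subseteq> ample_classes J" "\<forall>C\<in>S. t C > 0"
    and N: "N = (\<Sum>C\<in>S. t C *\<^sub>R C)"
    using assms(1) by (auto simp: ample_cone_def)
  have "r *\<^sub>R N = (\<Sum>C\<in>S. (r * t C) *\<^sub>R C)" by (simp add: N scaleR_sum_right)
  moreover have "\<forall>C\<in>S. r * t C > 0" using S(4) assms(2) by simp
  ultimately show ?thesis using S(1-3) unfolding ample_cone_def by fast
qed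

lemma ample_cone_add:
  assumes "M \<in> ample_cone J" "N \<in> ample_cone J"
  shows "M + N \<in> ample_cone J"
proof -
  obtain S s where S: "finite S" "S \<noteq> {}" "S \<subseteq> ample_classes J" "\<forall>C\<in>S. s C > 0"
    and M: "M = (\<Sum>C\<in>S. s C *\<^sub>R C)"
    using assms(1) by (auto simp: ample_cone_def)
  obtain T t where T: "finite T" "T \<noteq> {}" "T \<subseteq> ample_classes J" "\<forall>C\<in>T. t C > 0"
    and N: "N = (\<Sum>C\<in>T. t C *\<^sub>R C)"
    using assms(2) by (auto simp: ample_cone_def)
  define r where "r C = (if C \<in> S then s C else 0) + (if C \<in> T then t C else 0)" for C
  have "M = (\<Sum>C\<in>S \<union> T. (if C \<in> S then s C else 0) *\<^sub>R C)"
    unfolding M using S(1) T(1) by (intro sum.mono_neutral_cong_left) auto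
  moreover have "N = (\<Sum>C\<in>S \<union> T. (if C \<in> T then t C else 0) *\<^sub>R C)"
    unfolding N using S(1) T(1) by (intro sum.mono_neutral_cong_left) auto
  ultimately have "M + N = (\<Sum>C\<in>S \<union> T. r C *\<^sub>R C)"
    by (simp add: r_def scaleR_add_left sum.distrib)
  moreover have "\<forall>C\<in>S \<union> T. r C > 0"
    using S(4) T(4) by (auto simp: r_def add_pos_pos)
  moreover have "finite (S \<union> T)" "S \<union> T \<noteq> {}" "S \<union> T \<subseteq> ample_classes J"
    using S(1-3) T(1-3) by auto
  ultimately show ?thesis unfolding ample_cone_def by fast
qed

lemma ample_classes_subset_cone: "C \<in> ample_classes J \<Longrightarrow> C \<in> ample_cone J"
  unfolding ample_cone_def
  by (intro CollectI exI [of _ "{C}"] exI [of _ "\<lambda>_. 1"]) auto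

lemma positive_definite_ample_cone:
  assumes "N \<in> ample_cone J"
  shows "positive_definite (hermitian J N)"
proof -
  obtain S t where S: "finite S" "S \<noteq> {}" "S \<subseteq> ample_classes J" "\<forall>C\<in>S. t C > 0"
    and N: "N = (\<Sum>C\<in>S. t C *\<^sub>R C)"
    using assms(1) by (auto simp: ample_cone_def)
  have *: "hermitian J N = (\<Sum>C\<in>S. t C *\<^sub>R hermitian J C)"
    by (simp add: N linear_sum [OF hermitian_linear] linear_cmul [OF hermitian_linear])
  show ?thesis
    unfolding positive_definite_def * quadratic_form_sum
    using S by (auto intro!: sum_pos simp: ample_classes_iff positive_definite_def)
qed

lemma ample_cone_subset_NS_real: "ample_cone J \<subseteq> NS_real J"
  by (auto simp: ample_cone_def NS_real_def ample_classes_iff subset_iff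
      intro!: span_sum intro: span_scale span_base)

lemma NS_int_combination:
  assumes J: "complex_structure J" and "S \<subseteq> NS J"
  shows "(\<Sum>C\<in>S. of_int (p C) *\<^sub>R C) \<in> NS J"
  using \<open>S \<subseteq> NS J\<close>
proof (induction S rule: infinite_finite_induct)
  case (insert C S)
  then have "C \<in> NS J" "(\<Sum>C\<in>S. of_int (p C) *\<^sub>R C) \<in> NS J" by auto
  then show ?case using insert.hyps
    by (simp add: NS_iff [OF J] hom_tori_iff matrix_ring matrix_scaleR_left matrix_scaleR_right transpose_ring)
qed (simp_all add: NS_iff [OF J] hom_tori_iff transpose_zero matrix_zero_left matrix_zero_right)

text \<open>Large multiples of an ample class absorb any class, so the ample classes span \<open>NS \<otimes> \<real>\<close>, and
  \<open>N = \<Sum> u\<^sub>b b\<close> over a basis of ample classes. Rounding the coefficients of \<open>m N\<close> down gives an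
  integral class that is still positive definite when \<open>m\<close> is large, and the remainders are positive.\<close>

lemma ample_cone_iff:
  assumes J: "complex_structure J" and ample: "ample_classes J \<noteq> {}"
  shows "N \<in> ample_cone J \<longleftrightarrow> N \<in> NS_real J \<and> positive_definite (hermitian J N)"
proof
  assume "N \<in> ample_cone J"
  then show "N \<in> NS_real J \<and> positive_definite (hermitian J N)"
    using positive_definite_ample_cone ample_cone_subset_NS_real by blast
next
  assume N: "N \<in> NS_real J \<and> positive_definite (hermitian J N)"
  obtain C where C: "C \<in> ample_classes J" using ample by blast
  have "b \<in> span (ample_classes J)" if b: "b \<in> NS J" for b
  proof -
    obtain e where e: "e > 0" "\<And>d. \<bar>d\<bar> \<le> e \<Longrightarrow> positive_definite (hermitian J C + d *\<^sub>R hermitian J b)"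
      using positive_definite_perturb C by (metis ample_classes_iff)
    obtain k :: nat where k: "0 < k" "1 / real k < e"
      using nat_approx_posE [OF e(1)] by (metis zero_less_Suc)
    define a where "a = b + real k *\<^sub>R C"
    have "hermitian J a = real k *\<^sub>R (hermitian J C + (1 / real k) *\<^sub>R hermitian J b)"
      using k(1) by (simp add: a_def linear_add [OF hermitian_linear] linear_cmul [OF hermitian_linear]
          scaleR_add_right)
    then have "positive_definite (hermitian J a)"
      using e(2) [of "1 / real k"] k
      by (simp add: positive_definite_def scaleR_matrix_vector_assoc [symmetric])
    moreover have "a \<in> NS J"
      using b C by (simp add: a_def NS_iff [OF J] ample_classes_iff hom_tori_iff matrix_ring
          matrix_scaleR_left matrix_scaleR_right transpose_ring)
    ultimately have "a \<in> ample_classes J" by (simp add: ample_classes_iff)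
    then have "a - real k *\<^sub>R C \<in> span (ample_classes J)"
      using C by (intro span_diff span_scale span_base)
    then show ?thesis by (simp add: a_def)
  qed
  then have "NS_real J \<subseteq> span (ample_classes J)"
    unfolding NS_real_def by (intro span_minimal) auto
  moreover obtain B where B: "B \<subseteq> ample_classes J" "independent B" "ample_classes J \<subseteq> span B"
    using basis_exists [of "ample_classes J"] by metis
  moreover have "span (ample_classes J) \<subseteq> span B"
    by (intro span_minimal B(3) subspace_span)
  ultimately have NB: "N \<in> span B" using N by (meson subsetD)
  have fin: "finite B" using B(2) independent_imp_finite by blast
  have "N \<in> range (\<lambda>u. \<Sum>b\<in>B. u b *\<^sub>R b)"
    using NB unfolding span_finite [OF fin] .
  then obtain u where u: "N = (\<Sum>b\<in>B. u b *\<^sub>R b)" by (elim rangeE)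
  define D where "D = (\<Sum>b\<in>B. b)"
  have hN: "hermitian J N = (\<Sum>b\<in>B. u b *\<^sub>R hermitian J b)"
    by (simp add: u linear_sum [OF hermitian_linear] linear_cmul [OF hermitian_linear])
  have hD: "hermitian J D = (\<Sum>b\<in>B. 1 *\<^sub>R hermitian J b)"
    by (simp add: D_def linear_sum [OF hermitian_linear])
  obtain e where e: "e > 0" "\<And>d. \<bar>d\<bar> \<le> e \<Longrightarrow> positive_definite (hermitian J N + d *\<^sub>R hermitian J D)"
    using positive_definite_perturb N by metis
  obtain m :: nat where m: "0 < m" "1 / real m < e"
    using nat_approx_posE [OF e(1)] by (metis zero_less_Suc)
  \<comment> \<open>The \<open>- 1\<close> makes the inequality on the right strict, as the ample cone needs positive coefficients.\<close>
  define p where "p b = \<lceil>real m * u b\<rceil> - 1" for b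
  have p: "real m * u b - 1 \<le> of_int (p b)" "of_int (p b) < real m * u b" for b
    unfolding p_def by linarith+
  define M where "M = (\<Sum>b\<in>B. of_int (p b) *\<^sub>R b)"
  have "positive_definite (hermitian J M)"
    unfolding positive_definite_def
  proof safe
    fix v :: "real ^ 'a" assume v: "v \<noteq> 0"
    have "0 < ((hermitian J N + (- 1 / real m) *\<^sub>R hermitian J D) *v v) \<bullet> v"
      using e(2) [of "- 1 / real m"] m v by (simp add: positive_definite_def)
    also have "\<dots> = (\<Sum>b\<in>B. (u b - 1 / real m) * ((hermitian J b *v v) \<bullet> v))"
      unfolding hN hD
      by (simp only: scaleR_sum_right scaleR_scaleR sum.distrib [symmetric] scaleR_add_left [symmetric]
          quadratic_form_sum) simp
    finally have "0 < real m * (\<Sum>b\<in>B. (u b - 1 / real m) * ((hermitian J b *v v) \<bullet> v))"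
      using m by simp
    also have "\<dots> = (\<Sum>b\<in>B. (real m * u b - 1) * ((hermitian J b *v v) \<bullet> v))"
      unfolding sum_distrib_left mult.assoc [symmetric] right_diff_distrib using m(1) by simp
    also have "\<dots> \<le> (\<Sum>b\<in>B. of_int (p b) * ((hermitian J b *v v) \<bullet> v))"
      using B(1) v
      by (intro sum_mono mult_right_mono p) (auto simp: ample_classes_iff positive_definite_def less_imp_le)
    also have "\<dots> = (hermitian J M *v v) \<bullet> v"
      by (simp add: M_def linear_sum [OF hermitian_linear] linear_cmul [OF hermitian_linear]
          quadratic_form_sum)
    finally show "0 < (hermitian J M *v v) \<bullet> v" .
  qed
  moreover have "M \<in> NS J"
    unfolding M_def using B(1) by (intro NS_int_combination J) (auto simp: ample_classes_iff)
  ultimately have M: "M \<in> ample_cone J"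
    by (simp add: ample_classes_iff ample_classes_subset_cone)
  have "M + (\<Sum>b\<in>B'. (real m * u b - of_int (p b)) *\<^sub>R b) \<in> ample_cone J" if "B' \<subseteq> B" for B'
    using finite_subset [OF that fin] that
  proof (induction B' rule: finite_induct)
    case empty
    then show ?case using M by simp
  next
    case (insert b B')
    then have "(real m * u b - of_int (p b)) *\<^sub>R b \<in> ample_cone J"
      using p(2) [of b] B(1) by (intro ample_cone_scaleR ample_classes_subset_cone) auto
    moreover have "M + (\<Sum>b\<in>B'. (real m * u b - of_int (p b)) *\<^sub>R b) \<in> ample_cone J"
      using insert by blast
    ultimately have "(real m * u b - of_int (p b)) *\<^sub>R b
        + (M + (\<Sum>b\<in>B'. (real m * u b - of_int (p b)) *\<^sub>R b)) \<in> ample_cone J"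
      by (rule ample_cone_add)
    then show ?case using insert.hyps by (simp add: add.left_commute)
  qed
  from this [of B] have "M + (\<Sum>b\<in>B. (real m * u b - of_int (p b)) *\<^sub>R b) \<in> ample_cone J" by simp
  moreover have "M + (\<Sum>b\<in>B. (real m * u b - of_int (p b)) *\<^sub>R b) = real m *\<^sub>R N"
    unfolding M_def u by (simp add: scaleR_diff_left sum_subtractf scaleR_sum_right)
  ultimately have "real m *\<^sub>R N \<in> ample_cone J" by simp
  from ample_cone_scaleR [OF this, of "1 / real m"] m(1) show "N \<in> ample_cone J" by simp
qed

section \<open>The isometry group of the evaluation pairing\<close>

lemma block_select [simp]:
  "block_a (block a b c d) = a" "block_b (block a b c d) = b"
  "block_c (block a b c d) = c" "block_d (block a b c d) = d"
  by (simp_all add: vec_eq_iff block_def block_a_def block_b_def block_c_def block_d_def)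

lemma block_eta: "block (block_a g) (block_b g) (block_c g) (block_d g) = g"
  by (auto simp: vec_eq_iff block_def block_a_def block_b_def block_c_def block_d_def split: sum.split)

lemma block_eq_iff:
  "block a b c d = block a' b' c' d' \<longleftrightarrow> a = a' \<and> b = b' \<and> c = c' \<and> d = d'"
  by (metis block_select)

lemma sum_UNIV_Plus:
  fixes f :: "'a::finite + 'b::finite \<Rightarrow> 'c::comm_monoid_add"
  shows "sum f UNIV = (\<Sum>k\<in>UNIV. f (Inl k)) + (\<Sum>k\<in>UNIV. f (Inr k))"
  by (simp add: UNIV_Plus_UNIV [symmetric] sum.Plus del: UNIV_Plus_UNIV)

lemma block_mult:
  "block a b c d ** block a' b' c' d'
    = block (a ** a' + b ** c') (a ** b' + b ** d') (c ** a' + d ** c') (c ** b' + d ** d')"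
  by (auto simp: vec_eq_iff block_def matrix_matrix_mult_def sum_UNIV_Plus split: sum.split)

lemma block_scaleR: "r *\<^sub>R block a b c d = block (r *\<^sub>R a) (r *\<^sub>R b) (r *\<^sub>R c) (r *\<^sub>R d)"
  by (auto simp: vec_eq_iff block_def split: sum.split)

lemma block_minus: "- block a b c d = block (- a) (- b) (- c) (- d)"
  by (auto simp: vec_eq_iff block_def split: sum.split)

lemma mat_one_block: "mat 1 = block (mat 1) 0 0 (mat 1)"
  by (auto simp: vec_eq_iff block_def mat_def split: sum.split)

lemma transpose_block:
  "transpose (block a b c d) = block (transpose a) (transpose c) (transpose b) (transpose d)"
  by (auto simp: vec_eq_iff block_def transpose_def split: sum.split)

lemma block_cases: obtains a b c d where "g = block a b c d"
  by (metis block_eta)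

text \<open>The symmetric form \<open>((v, w), (v', w')) \<mapsto> w(v') + w'(v)\<close> on \<open>V \<oplus> V\<^sup>*\<close>.\<close>

definition pairing :: "real ^ ('n::finite + 'n) ^ ('n + 'n)" where
  "pairing = block 0 (mat 1) (mat 1) 0"

text \<open>The complex structure of \<open>A \<times> \<hat>A\<close>.\<close>

definition product_structure :: "real ^ 'n ^ 'n \<Rightarrow> real ^ ('n::finite + 'n) ^ ('n + 'n)" where
  "product_structure J = block J 0 0 (dual_structure J)"

lemma pairing_pairing: "pairing ** pairing = mat 1"
  by (simp add: pairing_def block_mult mat_one_block matrix_ring)

lemma transpose_pairing: "transpose pairing = pairing"
  by (simp add: pairing_def transpose_block transpose_zero)

lemma formal_inverse_block:
  "formal_inverse (block a b c d) = block (transpose d) (transpose b) (transpose c) (transpose a)"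
  by (simp add: formal_inverse_def dual_end_def dual_cross_def)

text \<open>The formal inverse is the adjoint for the evaluation pairing, so the group consists of the isometries
  of this pairing.\<close>

lemma formal_inverse_eq: "formal_inverse g = pairing ** transpose g ** pairing"
  by (cases g rule: block_cases)
    (simp add: pairing_def formal_inverse_block transpose_block block_mult matrix_ring)

lemma formal_inverse_mult: "formal_inverse (g ** h) = formal_inverse h ** formal_inverse g"
  by (simp add: formal_inverse_eq matrix_transpose_mul matrix_mul_assoc [symmetric]
      matrix_cancel [OF pairing_pairing])

lemma formal_inverse_involutive: "formal_inverse (formal_inverse g) = g"
  by (cases g rule: block_cases) (simp add: formal_inverse_block)

lemma formal_inverse_one: "formal_inverse (mat 1) = mat 1"
  by (simp add: formal_inverse_eq pairing_pairing)

text \<open>The algebra \<open>End(A \<times> \<hat>A) \<otimes> \<real>\<close>.\<close>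

definition end_real :: "real ^ 'n ^ 'n \<Rightarrow> (real ^ ('n::finite + 'n) ^ ('n + 'n)) set" where
  "end_real J = {g. block_a g \<in> hom_real J J
                  \<and> block_b g \<in> hom_real (dual_structure J) J
                  \<and> block_c g \<in> hom_real J (dual_structure J)
                  \<and> block_d g \<in> hom_real (dual_structure J) (dual_structure J)}"

lemma block_in_end_real:
  "block a b c d \<in> end_real J \<longleftrightarrow> a \<in> hom_real J J \<and> b \<in> hom_real (dual_structure J) J
    \<and> c \<in> hom_real J (dual_structure J) \<and> d \<in> hom_real (dual_structure J) (dual_structure J)"
  by (simp add: end_real_def)

lemma end_real_mult: "g \<in> end_real J \<Longrightarrow> h \<in> end_real J \<Longrightarrow> g ** h \<in> end_real J"
  by (cases g rule: block_cases; cases h rule: block_cases)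
    (auto simp: block_in_end_real block_mult intro!: hom_real_ops(1) intro: hom_real_mult)

lemma end_real_one: "mat 1 \<in> end_real J"
  by (simp add: mat_one_block block_in_end_real hom_real_one hom_real_ops)

lemma end_real_formal_inverse:
  assumes "g \<in> end_real J"
  shows "formal_inverse g \<in> end_real J"
proof (cases g rule: block_cases)
  case (1 a b c d)
  show ?thesis
    using assms hom_real_transpose [of a J J] hom_real_transpose [of b "dual_structure J" J]
      hom_real_transpose [of c J "dual_structure J"]
      hom_real_transpose [of d "dual_structure J" "dual_structure J"]
    by (simp add: 1 formal_inverse_block block_in_end_real dual_dual_structure)
qed

lemma end_real_commutes:
  assumes "g \<in> end_real J"
  shows "g ** product_structure J = product_structure J ** g"
  using assms
  by (cases g rule: block_cases)
    (auto simp: product_structure_def block_mult block_in_end_real matrix_ring block_eq_iff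
      dest: hom_real_intertwines)

lemma closed_end_real: "closed (end_real J)"
proof -
  have cl: "closed (hom_real J1 J2)" for J1 :: "real ^ 'n ^ 'n" and J2 :: "real ^ 'n ^ 'n"
    by (rule closed_subspace [OF subspace_hom_real])
  show ?thesis unfolding end_real_def block_a_def block_b_def block_c_def block_d_def
    by (intro closed_Collect_conj; rule closed_vimage [OF cl, unfolded vimage_def])
      (intro continuous_intros continuous_on_vec_lambda)+
qed

lemma U_group_simps:
  "carrier (U_group J) = {g \<in> end_real J. g ** formal_inverse g = mat 1 \<and> formal_inverse g ** g = mat 1}"
  "g \<otimes>\<^bsub>U_group J\<^esub> h = g ** h" "\<one>\<^bsub>U_group J\<^esub> = mat 1"
  by (auto simp: U_group_def end_real_def)

lemma in_U_group_iff:
  "g \<in> carrier (U_group J) \<longleftrightarrow> g \<in> end_real J \<and> formal_inverse g ** g = mat 1"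
  by (auto simp: U_group_simps matrix_left_right_inverse)

lemma U_group_inverse:
  assumes "g \<in> carrier (U_group J)"
  shows "g ** formal_inverse g = mat 1" "formal_inverse g ** g = mat 1"
  using assms by (simp_all add: U_group_simps)

lemma U_group_formal_inverse:
  "g \<in> carrier (U_group J) \<Longrightarrow> formal_inverse g \<in> carrier (U_group J)"
  by (simp add: U_group_simps end_real_formal_inverse formal_inverse_involutive)

lemma U_group_mult:
  assumes "g \<in> carrier (U_group J)" "h \<in> carrier (U_group J)"
  shows "g ** h \<in> carrier (U_group J)"
  using assms unfolding in_U_group_iff
  by (auto simp: formal_inverse_mult matrix_mul_assoc [symmetric] matrix_cancel intro: end_real_mult)

lemma U_group_one: "mat 1 \<in> carrier (U_group J)"
  by (simp add: in_U_group_iff end_real_one formal_inverse_one)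

lemma group_U_group: "group (U_group J)"
proof (rule groupI)
  fix g assume "g \<in> carrier (U_group J)"
  then show "\<exists>h\<in>carrier (U_group J). h \<otimes>\<^bsub>U_group J\<^esub> g = \<one>\<^bsub>U_group J\<^esub>"
    using U_group_formal_inverse U_group_inverse(2) by (force simp: U_group_simps(2,3))
qed (auto simp: U_group_simps(2,3) U_group_one matrix_mul_assoc intro: U_group_mult)

lemma U_group_inv: "g \<in> carrier (U_group J) \<Longrightarrow> inv\<^bsub>U_group J\<^esub> g = formal_inverse g"
  using group.inv_equality [OF group_U_group] U_group_formal_inverse U_group_inverse
  by (metis U_group_simps(2,3))

section \<open>Complexified matrices\<close>

lemma cmat_ring:
  "cmat (A + B) = cmat A + cmat B" "cmat (A - B) = cmat A - cmat B" "cmat (- A) = - cmat A"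
  "cmat (C ** D) = cmat C ** cmat D" "cmat 0 = 0" "cmat (mat 1) = mat 1"
  by (simp_all add: vec_eq_iff cmat_def map_matrix_def matrix_matrix_mult_def mat_def)

lemma mat_mult_component: "(mat c ** A) $ i $ j = c * A $ i $ j" for A :: "'a::semiring_1 ^ 'n ^ 'm"
proof -
  have "(mat c ** A) $ i $ j = (\<Sum>k\<in>UNIV. if i = k then c * A $ k $ j else 0)"
    unfolding matrix_matrix_mult_def mat_def by (simp only: vec_lambda_beta) (intro sum.cong refl, simp)
  then show ?thesis by simp
qed

lemma mat_scalar_commute: "A ** mat c = mat c ** A" for A :: "'a::comm_ring_1 ^ 'n ^ 'm"
proof -
  have "(A ** mat c) $ i $ j = (\<Sum>k\<in>UNIV. if k = j then A $ i $ k * c else 0)" for i j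
    unfolding matrix_matrix_mult_def mat_def by (simp only: vec_lambda_beta) (intro sum.cong refl, simp)
  then show ?thesis by (simp add: vec_eq_iff mat_mult_component mult.commute)
qed

lemma mat_i_mat_i: "mat \<i> ** mat \<i> = - mat 1"
  by (simp add: vec_eq_iff mat_mult_component) (simp add: mat_def)

lemma complex_mat_eq: "complex_mat M N = cmat M + mat \<i> ** cmat N"
  by (simp add: vec_eq_iff mat_mult_component complex_mat_def cmat_def map_matrix_def complex_eq_iff)

definition re_mat :: "complex ^ 'n ^ 'm \<Rightarrow> real ^ 'n ^ 'm" where
  "re_mat = map_matrix Re"

definition im_mat :: "complex ^ 'n ^ 'm \<Rightarrow> real ^ 'n ^ 'm" where
  "im_mat = map_matrix Im"

lemma complex_mat_parts [simp]:
  "re_mat (complex_mat M N) = M" "im_mat (complex_mat M N) = N"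
  "complex_mat (re_mat w) (im_mat w) = w"
  by (simp_all add: vec_eq_iff complex_mat_def re_mat_def im_mat_def map_matrix_def)

section \<open>Points of the half spaces as complex structures\<close>

lemma positive_definite_congruence:
  fixes A B :: "real ^ 'n ^ 'n"
  assumes pos: "positive_definite (transpose B ** A ** B)" and inv: "B ** B' = mat 1"
  shows "positive_definite A"
  unfolding positive_definite_def
proof safe
  fix v :: "real ^ 'n" assume v: "v \<noteq> 0"
  define w where "w = B' *v v"
  have vw: "v = B *v w" by (simp add: w_def matrix_vector_mul_assoc inv)
  then have "w \<noteq> 0" using v by auto
  then have "0 < ((transpose B ** A ** B) *v w) \<bullet> w" using pos by (simp add: positive_definite_def)
  then show "0 < (A *v v) \<bullet> v"
    by (simp add: vw matrix_vector_mul_assoc [symmetric] inner_matrix_vector [of "transpose B"]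
        del: transpose_matrix_vector)
qed

lemma positive_definite_transpose: "positive_definite (transpose A) \<longleftrightarrow> positive_definite A"
proof -
  have "(transpose A *v v) \<bullet> v = (A *v v) \<bullet> v" for v
    by (metis inner_commute inner_matrix_vector)
  then show ?thesis unfolding positive_definite_def by simp
qed

lemma quadratic_form_block_diagonal:
  fixes a d :: "real ^ 'n ^ 'n" and x :: "real ^ ('n::finite + 'n)"
  defines "y \<equiv> \<chi> k. x $ Inl k" and "z \<equiv> \<chi> k. x $ Inr k"
  shows "(block a 0 0 d *v x) \<bullet> x = (a *v y) \<bullet> y + (d *v z) \<bullet> z"
  by (simp add: inner_vec_def matrix_vector_mult_def block_def sum_UNIV_Plus y_def z_def)

lemma positive_definite_block_diagonal:
  assumes "positive_definite a" "positive_definite d"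
  shows "positive_definite (block a 0 0 d)"
  unfolding positive_definite_def quadratic_form_block_diagonal
proof safe
  fix x :: "real ^ ('a + 'a)" assume "x \<noteq> 0"
  then obtain i where i: "x $ i \<noteq> 0" by (auto simp: vec_eq_iff)
  let ?y = "\<chi> k. x $ Inl k" and ?z = "\<chi> k. x $ Inr k"
  have "?y \<noteq> 0 \<or> ?z \<noteq> 0" using i by (cases i) (auto simp: vec_eq_iff)
  moreover have "0 \<le> (a *v ?y) \<bullet> ?y" "0 \<le> (d *v ?z) \<bullet> ?z"
    using assms by (auto simp: positive_definite_def intro: less_imp_le dest: spec [of _ ?y] spec [of _ ?z])
  ultimately show "0 < (a *v ?y) \<bullet> ?y + (d *v ?z) \<bullet> ?z"
    using assms by (auto simp: positive_definite_def intro: add_pos_nonneg add_nonneg_pos)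
qed

lemma positive_definite_lower_right_block:
  assumes "positive_definite (block a b c d)"
  shows "positive_definite d"
  unfolding positive_definite_def
proof safe
  fix z :: "real ^ 'a" assume "z \<noteq> 0"
  define x :: "real ^ ('a + 'a)" where "x = (\<chi> i. case i of Inl k \<Rightarrow> 0 | Inr k \<Rightarrow> z $ k)"
  obtain k where "z $ k \<noteq> 0" using \<open>z \<noteq> 0\<close> by (auto simp: vec_eq_iff)
  then have "x $ Inr k \<noteq> 0" by (simp add: x_def)
  then have "x \<noteq> 0" by (metis zero_index)
  then have "0 < (block a b c d *v x) \<bullet> x" using assms by (simp add: positive_definite_def)
  also have "\<dots> = (d *v z) \<bullet> z"
    by (simp add: inner_vec_def matrix_vector_mult_def block_def sum_UNIV_Plus x_def)
  finally show "0 < (d *v z) \<bullet> z" .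
qed

text \<open>The sign \<open>e\<close> allows both components of the domain to be treated at once: \<open>e = 1\<close> gives
  \<open>C_plus\<close> and \<open>e = -1\<close> gives \<open>C_minus\<close>.\<close>

definition half_space :: "real ^ 'n ^ 'n \<Rightarrow> real \<Rightarrow> (complex ^ 'n ^ 'n) set" where
  "half_space J e = {complex_mat M N | M N. M \<in> NS_real J \<and> N \<in> NS_real J
     \<and> positive_definite (e *\<^sub>R hermitian J N)}"

definition structure_metric :: "real ^ 'n ^ 'n \<Rightarrow> real ^ ('n::finite + 'n) ^ ('n + 'n) \<Rightarrow> real ^ ('n + 'n) ^ ('n + 'n)" where
  "structure_metric J I = pairing ** product_structure J ** I"

text \<open>The condition on the formal inverse says that \<open>I\<close> is skew for the pairing; together with \<open>I\<^sup>2 = -1\<close> it puts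
  \<open>I\<close> into the group.\<close>

definition structures :: "real ^ 'n ^ 'n \<Rightarrow> real \<Rightarrow> (real ^ ('n::finite + 'n) ^ ('n + 'n)) set" where
  "structures J e = {I \<in> end_real J. formal_inverse I = - I \<and> I ** I = - mat 1
     \<and> positive_definite (e *\<^sub>R structure_metric J I)}"

text \<open>With \<open>P = N\<^sup>-\<^sup>1\<close> this is the real operator with eigenvalue \<open>i\<close> on the graph of
  \<open>M + i N\<close>. Real and imaginary parts of the eigenvectors give \<open>I (v, M v) = (0, - N v)\<close> and
  \<open>I (0, N v) = (v, M v)\<close>, and the blocks follow.\<close>

definition graph_structure ::
  "real ^ 'n ^ 'n \<Rightarrow> real ^ 'n ^ 'n \<Rightarrow> real ^ 'n ^ 'n \<Rightarrow> real ^ ('n::finite + 'n) ^ ('n + 'n)" where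
  "graph_structure M N P = block (- (P ** M)) P (- N - M ** (P ** M)) (M ** P)"

lemma structure_metric_block:
  "structure_metric J (block a b c d)
    = block (dual_structure J ** c) (dual_structure J ** d) (J ** a) (J ** b)"
  by (simp add: structure_metric_def pairing_def product_structure_def block_mult matrix_ring)

lemma positive_definite_scaleR_inverse:
  fixes A B :: "real ^ 'n ^ 'n"
  assumes "positive_definite (e *\<^sub>R (A ** B))"
  obtains B' where "B ** B' = mat 1" "B' ** B = mat 1"
  using positive_definite_inverse [of "e *\<^sub>R A" B] assms by (metis matrix_scaleR_left)

context
  fixes J :: "real ^ 'n ^ 'n"
  assumes av: "abelian_variety J"
begin

lemma abelian_variety_complex_structure: "complex_structure J"
  and abelian_variety_ample: "ample_classes J \<noteq> {}"
  using av by (simp_all add: abelian_variety_def)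

text \<open>An ample class is an isogeny from the torus to its dual.\<close>

lemma dual_hom_invertible:
  obtains h k where "h \<in> hom_real (dual_structure J) J" "k \<in> hom_real J (dual_structure J)"
    "h ** k = mat 1" "k ** h = mat 1"
proof -
  obtain C where C: "C \<in> NS J" "positive_definite (hermitian J C)"
    using abelian_variety_ample by (auto simp: ample_classes_iff)
  then have Ct: "C \<in> hom_tori J (dual_structure J)" by (simp add: NS_iff [OF abelian_variety_complex_structure])
  obtain h where "C ** h = mat 1" "h ** C = mat 1"
    using positive_definite_inverse C(2) unfolding hermitian_def by blast
  moreover from this have "h \<in> hom_real (dual_structure J) J" by (intro hom_tori_inverse [OF Ct])
  moreover have "C \<in> hom_real J (dual_structure J)" using Ct by (simp add: hom_real_def span_base)
  ultimately show ?thesis using that by blast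
qed

lemma hom_real_inverse_to_dual:
  assumes "f \<in> hom_real J (dual_structure J)" "f ** y = mat 1"
  shows "y \<in> hom_real (dual_structure J) J"
  using dual_hom_invertible hom_real_inverse [OF assms] by metis

lemma hom_real_inverse_from_dual:
  assumes "f \<in> hom_real (dual_structure J) J" "f ** y = mat 1"
  shows "y \<in> hom_real J (dual_structure J)"
  using dual_hom_invertible hom_real_inverse [OF assms] by metis

lemma NS_realD:
  assumes "M \<in> NS_real J"
  shows "M \<in> hom_real J (dual_structure J)" "transpose M = - M" "M ** J = dual_structure J ** M"
  using assms hom_real_intertwines by (auto simp: NS_real_iff [OF abelian_variety_complex_structure])

lemma C_plus_eq: "C_plus J = half_space J 1"
  unfolding C_plus_def half_space_def ample_cone_iff [OF abelian_variety_complex_structure abelian_variety_ample] by simp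

lemma C_minus_eq: "C_minus J = half_space J (- 1)"
proof -
  have "N \<in> ample_cone J \<longleftrightarrow> - N \<in> NS_real J \<and> positive_definite ((- 1) *\<^sub>R hermitian J (- N))" for N
    unfolding ample_cone_iff [OF abelian_variety_complex_structure abelian_variety_ample]
    by (simp add: linear_neg [OF hermitian_linear] subspace_neg [OF subspace_NS_real])
      (metis minus_minus subspace_NS_real subspace_neg)
  then show ?thesis
    unfolding C_minus_def half_space_def by (simp add: set_eq_iff) (metis minus_minus)
qed

text \<open>In the coordinates \<open>x = (v, M v + N u)\<close> the metric is \<open>N(v, J v) + N(u, J u)\<close>; the matrix \<open>B\<close> of the
  proof is this change of coordinates.\<close>

lemma graph_structure_in_structures:
  assumes M: "M \<in> NS_real J" and N: "N \<in> NS_real J"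
    and pos: "positive_definite (e *\<^sub>R hermitian J N)"
    and NP: "N ** P = mat 1" and PN: "P ** N = mat 1"
  shows "graph_structure M N P \<in> structures J e"
proof -
  note M = NS_realD [OF M] and N = NS_realD [OF N]
  have P: "P \<in> hom_real (dual_structure J) J" by (rule hom_real_inverse_to_dual [OF N(1) NP])
  have "transpose P ** N = - mat 1"
    using arg_cong [OF NP, of transpose] by (simp add: matrix_transpose_mul N(2) matrix_ring)
      (metis minus_minus)
  then have "transpose P ** N ** P = - P" by (simp add: matrix_minus_left)
  then have Pt: "transpose P = - P" by (simp add: matrix_mul_assoc [symmetric] NP)
  let ?I = "graph_structure M N P"
  have 1: "?I \<in> end_real J"
    unfolding graph_structure_def block_in_end_real
    using M(1) N(1) P by (auto intro!: hom_real_ops intro: hom_real_mult)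
  have 2: "formal_inverse ?I = - ?I"
    by (simp add: graph_structure_def formal_inverse_block block_minus block_eq_iff transpose_ring
        M N Pt matrix_ring)
  have 3: "?I ** ?I = - mat 1"
    by (simp add: graph_structure_def block_mult mat_one_block block_minus block_eq_iff matrix_ring
        NP PN matrix_cancel [OF NP] matrix_cancel [OF PN])
  define B where "B = block (mat 1) 0 M N"
  have BB: "B ** block (mat 1) 0 (- (P ** M)) P = mat 1"
    by (simp add: B_def block_mult mat_one_block block_eq_iff matrix_ring NP matrix_cancel [OF NP])
  have "structure_metric J ?I ** B = block (hermitian J N) (dual_structure J ** M) 0 J"
    by (simp add: B_def graph_structure_def structure_metric_block block_mult block_eq_iff matrix_ring PN
        matrix_cancel [OF PN] hermitian_def dual_structure_def)
  then have "transpose B ** structure_metric J ?I ** B = block (hermitian J N) 0 0 (hermitian J N)"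
    by (simp add: B_def transpose_block block_mult block_eq_iff matrix_ring transpose_zero M N
        hermitian_def dual_structure_def matrix_mul_assoc [symmetric])
  then have "transpose B ** (e *\<^sub>R structure_metric J ?I) ** B
      = block (e *\<^sub>R hermitian J N) 0 0 (e *\<^sub>R hermitian J N)"
    by (simp add: matrix_scaleR_left matrix_scaleR_right block_scaleR)
  then have "positive_definite (transpose B ** (e *\<^sub>R structure_metric J ?I) ** B)"
    using positive_definite_block_diagonal [OF pos pos] by simp
  then have "positive_definite (e *\<^sub>R structure_metric J ?I)"
    by (rule positive_definite_congruence [OF _ BB])
  with 1 2 3 show ?thesis by (simp add: structures_def)
qed

text \<open>Restricted to \<open>0 \<oplus> V\<^sup>*\<close> the metric is \<open>J q\<close> for the upper right block \<open>q\<close> of \<open>I\<close>. By definiteness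
  \<open>q\<close> is invertible; its inverse is \<open>N\<close>, and \<open>I\<^sup>2 = -1\<close> determines the other blocks from \<open>q\<close> and
  \<open>M = s N\<close>.\<close>

lemma structures_cases:
  assumes "I \<in> structures J e"
  obtains M N P where "M \<in> NS_real J" "N \<in> NS_real J" "positive_definite (e *\<^sub>R hermitian J N)"
    "N ** P = mat 1" "P ** N = mat 1" "I = graph_structure M N P"
proof (cases I rule: block_cases)
  case (1 p q r s)
  have hom: "q \<in> hom_real (dual_structure J) J" "s \<in> hom_real (dual_structure J) (dual_structure J)"
    and fi: "block (transpose s) (transpose q) (transpose r) (transpose p) = block (- p) (- q) (- r) (- s)"
    and sq: "block (p ** p + q ** r) (p ** q + q ** s) (r ** p + s ** r) (r ** q + s ** s)
       = block (- mat 1) 0 0 (- mat 1)"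
    and pos: "positive_definite (e *\<^sub>R structure_metric J (block p q r s))"
    using assms by (simp_all add: structures_def 1 block_in_end_real formal_inverse_block block_minus
        block_mult mat_one_block)
  have t: "transpose s = - p" "transpose q = - q" using fi by (simp_all add: block_eq_iff)
  have pq: "p ** q = - (q ** s)" and rq: "r ** q = - mat 1 - s ** s"
    using sq by (simp_all add: block_eq_iff eq_neg_iff_add_eq_0 algebra_simps)
  have posq: "positive_definite (e *\<^sub>R (J ** q))"
    using pos unfolding structure_metric_block block_scaleR by (rule positive_definite_lower_right_block)
  obtain N where N: "q ** N = mat 1" "N ** q = mat 1"
    using positive_definite_scaleR_inverse [OF posq] by blast
  have Nhom: "N \<in> hom_real J (dual_structure J)" by (rule hom_real_inverse_from_dual [OF hom(1) N(1)])
  have "transpose N ** q = - mat 1"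
    using arg_cong [OF N(1), of transpose] by (simp add: matrix_transpose_mul t matrix_ring)
      (metis minus_minus)
  then have "transpose N ** q ** N = - N" by (simp add: matrix_minus_left)
  then have Nt: "transpose N = - N" by (simp add: matrix_mul_assoc [symmetric] N)
  define M where "M = s ** N"
  have p: "p = - (q ** M)"
  proof -
    have "p ** q ** N = - (q ** s) ** N" by (simp add: pq)
    then show ?thesis by (simp add: matrix_ring N M_def)
  qed
  have r: "r = - N - M ** (q ** M)"
  proof -
    have "r ** q ** N = (- mat 1 - s ** s) ** N" by (simp add: rq)
    then show ?thesis by (simp add: matrix_ring N M_def matrix_cancel [OF N(2)])
  qed
  have s: "s = M ** q" by (simp add: M_def matrix_mul_assoc [symmetric] N)
  have "transpose M = N ** p" by (simp add: M_def matrix_transpose_mul t Nt matrix_ring)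
  also have "\<dots> = - M" by (simp add: p matrix_ring matrix_cancel [OF N(2)])
  finally have Mt: "transpose M = - M" .
  have "M \<in> hom_real J (dual_structure J)" unfolding M_def using hom(2) Nhom by (rule hom_real_mult)
  then have "M \<in> NS_real J" "N \<in> NS_real J" using Mt Nt Nhom by (simp_all add: NS_real_iff [OF abelian_variety_complex_structure])
  moreover have "positive_definite (e *\<^sub>R hermitian J N)"
  proof -
    have "transpose q ** (e *\<^sub>R hermitian J N) ** q = transpose (e *\<^sub>R (J ** q))"
      by (simp add: hermitian_def transpose_ring matrix_scaleR_left matrix_scaleR_right
          matrix_mul_assoc [symmetric] N)
    then have "positive_definite (transpose q ** (e *\<^sub>R hermitian J N) ** q)"
      using posq by (simp add: positive_definite_transpose)
    then show ?thesis by (rule positive_definite_congruence [OF _ N(1)])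
  qed
  ultimately show ?thesis using that N p r s 1 by (simp add: graph_structure_def)
qed

end

section \<open>The action\<close>

lemma group_action_restrictI:
  fixes G (structure)
  assumes G: "group G"
    and cl: "\<And>g x. g \<in> carrier G \<Longrightarrow> x \<in> E \<Longrightarrow> f g x \<in> E"
    and one: "\<And>x. x \<in> E \<Longrightarrow> f \<one>\<^bsub>G\<^esub> x = x"
    and mult: "\<And>g h x. g \<in> carrier G \<Longrightarrow> h \<in> carrier G \<Longrightarrow> x \<in> E
      \<Longrightarrow> f (g \<otimes>\<^bsub>G\<^esub> h) x = f g (f h x)"
  shows "group_action G E (\<lambda>g. restrict (f g) E)"
proof -
  interpret group G by (rule G)
  have bij: "restrict (f g) E \<in> Bij E" if g: "g \<in> carrier G" for g
  proof -
    have "bij_betw (f g) E E"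
    proof (rule bij_betwI [where g = "f (inv g)"])
      show "f (inv g) (f g x) = x" if "x \<in> E" for x
        using mult [of "inv g" g x] g that one by simp
      show "f g (f (inv g) x) = x" if "x \<in> E" for x
        using mult [of g "inv g" x] g that one by simp
    qed (use g cl in auto)
    then show ?thesis by (simp add: Bij_def cong: bij_betw_cong)
  qed
  have "(\<lambda>g. restrict (f g) E) \<in> hom G (BijGroup E)"
  proof (rule homI)
    fix g h assume gh: "g \<in> carrier G" "h \<in> carrier G"
    show "restrict (f (g \<otimes> h)) E = restrict (f g) E \<otimes>\<^bsub>BijGroup E\<^esub> restrict (f h) E"
      using gh bij cl mult by (auto simp: BijGroup_def compose_def fun_eq_iff restrict_def)
  qed (simp add: BijGroup_def bij)
  then show ?thesis
    by (intro group_action.intro group_hom.intro group_hom_axioms.intro G group_BijGroup)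
qed

lemma matrix_inv_eq:
  fixes N :: "'a::semiring_1 ^ 'n ^ 'n"
  assumes "N ** P = mat 1" "P ** N = mat 1"
  shows "matrix_inv N = P"
proof -
  have "N ** matrix_inv N = mat 1 \<and> matrix_inv N ** N = mat 1"
    unfolding matrix_inv_def by (rule someI [of _ P]) (simp add: assms)
  then show ?thesis by (metis assms(2) matrix_mul_assoc matrix_mul_lid matrix_mul_rid)
qed

definition structure_of :: "complex ^ 'n ^ 'n \<Rightarrow> real ^ ('n::finite + 'n) ^ ('n + 'n)" where
  "structure_of w = graph_structure (re_mat w) (im_mat w) (matrix_inv (im_mat w))"

lemma half_space_cases:
  assumes "w \<in> half_space J e"
  obtains M N P where "w = complex_mat M N" "M \<in> NS_real J" "N \<in> NS_real J"
    "positive_definite (e *\<^sub>R hermitian J N)" "N ** P = mat 1" "P ** N = mat 1"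
    "structure_of w = graph_structure M N P"
proof -
  obtain M N where w: "w = complex_mat M N" "M \<in> NS_real J" "N \<in> NS_real J"
    and pos: "positive_definite (e *\<^sub>R hermitian J N)"
    using assms by (auto simp: half_space_def)
  moreover obtain P where P: "N ** P = mat 1" "P ** N = mat 1"
    using positive_definite_scaleR_inverse [OF pos [unfolded hermitian_def]] by blast
  moreover have "structure_of w = graph_structure M N P"
    by (simp add: structure_of_def w matrix_inv_eq [OF P])
  ultimately show ?thesis using that by blast
qed

text \<open>The upper right block of the operator determines \<open>N\<close>, the lower right one then determines \<open>M\<close>.\<close>

lemma structure_of_inj:
  assumes "w \<in> half_space J e" "w' \<in> half_space J e'" "structure_of w = structure_of w'"
  shows "w = w'"
proof -
  obtain M N P where 1: "w = complex_mat M N" "N ** P = mat 1" "P ** N = mat 1"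
      "structure_of w = graph_structure M N P"
    using assms(1) by (rule half_space_cases)
  obtain M' N' P' where 2: "w' = complex_mat M' N'" "N' ** P' = mat 1" "P' ** N' = mat 1"
      "structure_of w' = graph_structure M' N' P'"
    using assms(2) by (rule half_space_cases)
  have "graph_structure M N P = graph_structure M' N' P'"
    using assms(3) 1(4) 2(4) by simp
  then have eq: "P = P'" "M ** P = M' ** P'"
    unfolding graph_structure_def block_eq_iff by blast+
  then have "N = N'" using 1 2 by (metis matrix_inv_eq)
  moreover from eq have "M ** (P ** N) = M' ** (P ** N)" by (simp add: matrix_mul_assoc)
  ultimately show ?thesis using 1 2 by simp
qed

text \<open>The two rows say that \<open>I (v, \<omega> v) = i (v, \<omega> v)\<close>.\<close>

lemma graph_structure_eigenspace:
  fixes M N P :: "real ^ 'n ^ 'n"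
  assumes "P ** N = mat 1"
  defines "I \<equiv> graph_structure M N P" and "w \<equiv> complex_mat M N"
  shows "cmat (block_a I) + cmat (block_b I) ** w = mat \<i>"
    and "cmat (block_c I) + cmat (block_d I) ** w = mat \<i> ** w"
proof -
  have PN: "cmat P ** cmat N = mat 1" by (simp add: assms(1) cmat_ring(4) [symmetric] cmat_ring(6))
  have i: "cmat P ** (mat \<i> ** cmat N) = mat \<i> ** (cmat P ** cmat N)"
    by (simp add: matrix_mul_assoc mat_scalar_commute)
  show "cmat (block_a I) + cmat (block_b I) ** w = mat \<i>"
    by (simp add: I_def w_def graph_structure_def complex_mat_eq cmat_ring matrix_ring i PN)
  have "mat \<i> ** (mat \<i> ** cmat N) = - cmat N"
    by (simp add: matrix_mul_assoc mat_i_mat_i matrix_minus_left)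
  moreover have "cmat M ** mat \<i> = mat \<i> ** cmat M" by (rule mat_scalar_commute)
  ultimately show "cmat (block_c I) + cmat (block_d I) ** w = mat \<i> ** w"
    by (simp add: I_def w_def graph_structure_def complex_mat_eq cmat_ring matrix_ring i PN)
qed

text \<open>If \<open>I' g = g I\<close>, then \<open>g\<close> maps the eigenspace of \<open>I\<close> for \<open>i\<close> into that of \<open>I'\<close>, that is, the graph of
  \<open>\<omega>\<close> into the graph of \<open>\<omega>'\<close>. The first row of the eigenvector equation yields the
  claim, since its coefficient \<open>P'\<close> has the inverse \<open>N'\<close>.\<close>

lemma act_numerator:
  assumes PN: "P ** N = mat 1" and NP': "N' ** P' = mat 1"
    and conj: "graph_structure M' N' P' ** g = g ** graph_structure M N P"
  shows "cmat (block_c g) + cmat (block_d g) ** complex_mat M N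
    = complex_mat M' N' ** act_denom g (complex_mat M N)"
proof (cases g rule: block_cases)
  case (1 a b c d)
  define w where "w = complex_mat M N"
  define I where "I = graph_structure M N P"
  define X where "X = cmat a + cmat b ** w"
  define Y where "Y = cmat c + cmat d ** w"
  note eigen = graph_structure_eigenspace [OF PN, of M, folded I_def w_def]
  have row: "P' ** c - P' ** (M' ** a) = a ** block_a I + b ** block_c I"
    "P' ** d - P' ** (M' ** b) = a ** block_b I + b ** block_d I"
    using conj block_eta [of I, symmetric]
    by (simp_all add: 1 I_def graph_structure_def block_mult block_eq_iff matrix_ring)
  have "cmat P' ** Y - cmat P' ** (cmat M' ** X)
      = cmat (P' ** c - P' ** (M' ** a)) + cmat (P' ** d - P' ** (M' ** b)) ** w"
    by (simp add: X_def Y_def cmat_ring matrix_ring)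
  also have "\<dots> = cmat a ** (cmat (block_a I) + cmat (block_b I) ** w)
      + cmat b ** (cmat (block_c I) + cmat (block_d I) ** w)"
    unfolding row by (simp add: cmat_ring matrix_ring)
  also have "\<dots> = mat \<i> ** X"
    unfolding eigen X_def matrix_add_ldistrib
    by (simp only: matrix_mul_assoc mat_scalar_commute)
  finally have "cmat N' ** (cmat P' ** Y - cmat P' ** (cmat M' ** X)) = cmat N' ** (mat \<i> ** X)"
    by simp
  moreover have "cmat N' ** (cmat P' ** Z) = Z" for Z :: "complex ^ 'a ^ 'a"
    by (rule matrix_cancel) (simp add: cmat_ring(4) [symmetric] NP' cmat_ring(6))
  moreover have "cmat N' ** (mat \<i> ** X) = mat \<i> ** (cmat N' ** X)"
    by (simp only: matrix_mul_assoc mat_scalar_commute)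
  ultimately have "Y - cmat M' ** X = mat \<i> ** (cmat N' ** X)"
    by (simp only: matrix_diff_ldistrib)
  then have "Y = complex_mat M' N' ** X"
    by (simp add: complex_mat_eq matrix_ring diff_eq_eq add.commute)
  then show ?thesis by (simp add: X_def Y_def w_def 1 act_denom_def)
qed

lemma U_group_preserves_pairing:
  assumes "g \<in> carrier (U_group J)"
  shows "transpose g ** pairing ** g = pairing"
proof -
  have "pairing ** (formal_inverse g ** g) = pairing" by (simp add: U_group_inverse [OF assms])
  then show ?thesis
    by (simp add: formal_inverse_eq matrix_mul_assoc [symmetric] matrix_cancel [OF pairing_pairing])
qed

text \<open>Elements of the group preserve the pairing and commute with the complex structure of \<open>A \<times> \<hat>A\<close>, so
  the metric of a conjugate structure is the transported metric.\<close>

lemma structures_conjugate: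
  assumes g: "g \<in> carrier (U_group J)" and I: "I \<in> structures J e"
  shows "g ** I ** formal_inverse g \<in> structures J e"
proof -
  let ?I = "g ** I ** formal_inverse g"
  note gg = U_group_inverse [OF g]
  have mem: "g \<in> end_real J" "I \<in> end_real J" using g I by (simp_all add: U_group_simps structures_def)
  have 1: "?I \<in> end_real J"
    by (intro end_real_mult mem end_real_formal_inverse)
  have 2: "formal_inverse ?I = - ?I"
    using I by (simp add: formal_inverse_mult formal_inverse_involutive structures_def matrix_ring)
  have 3: "?I ** ?I = - mat 1"
  proof -
    have II: "I ** I = - mat 1" using I by (simp add: structures_def)
    have "?I ** ?I = g ** (I ** I) ** formal_inverse g"
      by (simp add: matrix_mul_assoc [symmetric] matrix_cancel [OF gg(2)])
    also have "\<dots> = - mat 1"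
      unfolding II by (simp add: matrix_minus_left matrix_minus_right gg)
    finally show ?thesis .
  qed
  have "transpose g ** structure_metric J ?I ** g = transpose g ** pairing ** (product_structure J ** g) ** I"
    by (simp add: structure_metric_def matrix_mul_assoc [symmetric] gg)
  also have "\<dots> = (transpose g ** pairing ** g) ** product_structure J ** I"
    by (simp add: end_real_commutes [OF mem(1), symmetric] matrix_mul_assoc)
  also have "\<dots> = structure_metric J I" by (simp add: U_group_preserves_pairing [OF g] structure_metric_def)
  finally have "transpose g ** (e *\<^sub>R structure_metric J ?I) ** g = e *\<^sub>R structure_metric J I"
    by (simp add: matrix_scaleR_left matrix_scaleR_right)
  then have "positive_definite (transpose g ** (e *\<^sub>R structure_metric J ?I) ** g)"
    using I by (simp add: structures_def)
  then have "positive_definite (e *\<^sub>R structure_metric J ?I)"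
    by (rule positive_definite_congruence [OF _ gg(1)])
  with 1 2 3 show ?thesis by (simp add: structures_def)
qed

context
  fixes J :: "real ^ 'n ^ 'n"
  assumes av: "abelian_variety J"
begin

lemma structure_of_in_structures:
  assumes "w \<in> half_space J e"
  shows "structure_of w \<in> structures J e"
  using assms by (rule half_space_cases) (simp add: graph_structure_in_structures [OF av])

text \<open>The conjugate of the operator of \<open>\<omega>\<close> is again the operator of some \<open>\<omega>'\<close>, and
  \<open>c + d \<omega> = \<omega>' (a + b \<omega>)\<close> by \<open>act_numerator\<close>. Hence \<open>a + b \<omega>\<close> is injective, for a vector in its kernel
  would give a vector of the graph of \<open>\<omega>\<close> in the kernel of \<open>g\<close>.\<close>

lemma act_conjugates:
  assumes g: "g \<in> carrier (U_group J)" and w: "w \<in> half_space J e"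
  shows "invertible (act_denom g w)" "act g w \<in> half_space J e"
    "structure_of (act g w) = g ** structure_of w ** formal_inverse g"
proof -
  note gg = U_group_inverse [OF g]
  obtain M N P where MN: "w = complex_mat M N" "N ** P = mat 1" "P ** N = mat 1"
      "structure_of w = graph_structure M N P"
    using w by (rule half_space_cases)
  obtain M' N' P' where MN': "M' \<in> NS_real J" "N' \<in> NS_real J"
      "positive_definite (e *\<^sub>R hermitian J N')" "N' ** P' = mat 1" "P' ** N' = mat 1"
      "g ** structure_of w ** formal_inverse g = graph_structure M' N' P'"
    using structures_cases [OF av structures_conjugate [OF g structure_of_in_structures [OF w]]] by metis
  define w' where "w' = complex_mat M' N'"
  have w': "w' \<in> half_space J e" unfolding w'_def half_space_def using MN' by blast
  have "graph_structure M' N' P' ** g = g ** graph_structure M N P"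
    unfolding MN'(6) [symmetric] MN(4) by (simp add: matrix_mul_assoc [symmetric] gg)
  from act_numerator [OF MN(3) MN'(4) this]
  have num: "cmat (block_c g) + cmat (block_d g) ** w = w' ** act_denom g w"
    by (simp add: MN(1) w'_def)
  \<comment> \<open>The first row of \<open>g\<^sup>-\<^sup>1 g = 1\<close>, applied to the graph of \<open>\<omega>\<close>, exhibits the left inverse.\<close>
  have left: "(cmat (transpose (block_d g)) + cmat (transpose (block_b g)) ** w') ** act_denom g w = mat 1"
  proof (cases g rule: block_cases)
    case (1 a b c d)
    have "transpose d ** a + transpose b ** c = mat 1" "transpose d ** b + transpose b ** d = 0"
      using gg(2) by (simp_all add: 1 formal_inverse_block block_mult mat_one_block block_eq_iff)
    then have row: "cmat (transpose d ** a + transpose b ** c) + cmat (transpose d ** b + transpose b ** d) ** w = mat 1"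
      by (simp add: cmat_ring matrix_zero_left)
    have "(cmat (transpose d) + cmat (transpose b) ** w') ** act_denom g w
        = cmat (transpose d) ** act_denom g w + cmat (transpose b) ** (cmat c + cmat d ** w)"
      using num by (simp add: 1 matrix_add_rdistrib matrix_mul_assoc [symmetric])
    also have "\<dots> = mat 1"
      using row by (simp add: 1 act_denom_def cmat_ring matrix_ring algebra_simps)
    finally show ?thesis by (simp add: 1)
  qed
  then have right: "act_denom g w ** (cmat (transpose (block_d g)) + cmat (transpose (block_b g)) ** w') = mat 1"
    by (simp add: matrix_left_right_inverse)
  show "invertible (act_denom g w)" using left right by (auto simp: invertible_def)
  have "act_denom g w ** matrix_inv (act_denom g w) = mat 1"
    using right by (simp add: matrix_inv_eq [OF right left])
  then have act: "act g w = w'"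
    unfolding act_def num by (simp add: matrix_mul_assoc [symmetric])
  show "act g w \<in> half_space J e" using act w' by simp
  show "structure_of (act g w) = g ** structure_of w ** formal_inverse g"
    by (simp add: act MN'(6)) (simp add: structure_of_def w'_def matrix_inv_eq [OF MN'(4,5)])
qed

lemma act_one: "w \<in> half_space J e \<Longrightarrow> act (mat 1) w = w"
  using act_conjugates [OF U_group_one, of w e]
  by (intro structure_of_inj) (auto simp: formal_inverse_one)

lemma act_mult:
  assumes g: "g \<in> carrier (U_group J)" and h: "h \<in> carrier (U_group J)" and w: "w \<in> half_space J e"
  shows "act (g ** h) w = act g (act h w)"
proof (rule structure_of_inj)
  note h' = act_conjugates [OF h w] and gh' = act_conjugates [OF U_group_mult [OF g h] w]
  note g' = act_conjugates [OF g h'(2)]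
  show "act (g ** h) w \<in> half_space J e" "act g (act h w) \<in> half_space J e"
    by (fact gh'(2) g'(2))+
  show "structure_of (act (g ** h) w) = structure_of (act g (act h w))"
    unfolding gh'(3) g'(3) h'(3) by (simp add: formal_inverse_mult matrix_mul_assoc)
qed

lemma act_fixes_iff:
  assumes g: "g \<in> carrier (U_group J)" and w: "w \<in> half_space J e"
  shows "act g w = w \<longleftrightarrow> g ** structure_of w = structure_of w ** g"
proof -
  note gg = U_group_inverse [OF g] and c = act_conjugates [OF g w]
  have "act g w = w \<longleftrightarrow> g ** structure_of w ** formal_inverse g = structure_of w"
    using structure_of_inj [OF c(2) w] c(3) by metis
  also have "\<dots> \<longleftrightarrow> g ** structure_of w = structure_of w ** g"
    by (metis gg matrix_mul_assoc matrix_mul_rid)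
  finally show ?thesis .
qed

lemma group_action_union:
  assumes "E = (\<Union>e\<in>T. half_space J e)"
  shows "group_action (U_group J) E (\<lambda>g. restrict (act g) E)"
proof (rule group_action_restrictI [OF group_U_group])
  show "act g x \<in> E" if "g \<in> carrier (U_group J)" "x \<in> E" for g x
    using that act_conjugates(2) assms by blast
  show "act \<one>\<^bsub>U_group J\<^esub> x = x" if "x \<in> E" for x
    using that act_one assms by (auto simp: U_group_simps)
  show "act (g \<otimes>\<^bsub>U_group J\<^esub> h) x = act g (act h x)"
    if "g \<in> carrier (U_group J)" "h \<in> carrier (U_group J)" "x \<in> E" for g h x
    using that act_mult assms by (auto simp: U_group_simps(2))
qed

end

section \<open>Stabilizers\<close>

lemma symmetric_form_Cauchy_Schwarz:
  fixes S :: "real ^ 'n ^ 'n"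
  assumes sym: "transpose S = S" and pos: "positive_definite S"
  shows "((S *v a) \<bullet> b)\<^sup>2 \<le> ((S *v a) \<bullet> a) * ((S *v b) \<bullet> b)"
proof (cases "b = 0")
  case False
  define q where "q = (S *v b) \<bullet> b"
  define r where "r = (S *v a) \<bullet> b"
  have q: "q > 0" using pos False by (simp add: positive_definite_def q_def)
  have sw: "(S *v b) \<bullet> a = r"
    unfolding r_def by (metis inner_commute inner_matrix_vector sym)
  define x where "x = a - (r / q) *\<^sub>R b"
  have "0 \<le> (S *v x) \<bullet> x"
    using pos by (cases "x = 0") (auto simp: positive_definite_def intro: less_imp_le)
  also have "\<dots> = (S *v a) \<bullet> a - (r / q) * r - (r / q) * (r - (r / q) * q)"
    unfolding x_def
    by (simp add: matrix_vector_mult_diff_distrib matrix_vector_mult_scaleR inner_diff_left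
        inner_diff_right sw flip: q_def r_def)
  also have "\<dots> = (S *v a) \<bullet> a - r\<^sup>2 / q" using q by (simp add: power2_eq_square)
  finally show ?thesis using q by (simp add: field_simps flip: q_def r_def)
qed simp

lemma symmetric_matrix_eqI:
  fixes A B :: "real ^ 'n ^ 'n"
  assumes sym: "transpose A = A" "transpose B = B"
    and eq: "\<And>x. (A *v x) \<bullet> x = (B *v x) \<bullet> x"
  shows "A = B"
proof -
  have sw: "(A *v y) \<bullet> x = (A *v x) \<bullet> y" "(B *v y) \<bullet> x = (B *v x) \<bullet> y" for x y
    by (metis inner_commute inner_matrix_vector sym(1)) (metis inner_commute inner_matrix_vector sym(2))
  have "(A *v x) \<bullet> y = (B *v x) \<bullet> y" for x y
    using eq [of "x + y"] eq [of x] eq [of y]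
    by (simp add: matrix_vector_right_distrib inner_add_left inner_add_right sw)
  then show ?thesis by (simp add: matrix_eq_iff_inner)
qed

lemma matrix_norm_le_sum_entries: "norm A \<le> (\<Sum>i\<in>UNIV. \<Sum>j\<in>UNIV. \<bar>A $ i $ j\<bar>)" for A :: "real ^ 'n ^ 'm"
proof -
  have "norm A \<le> (\<Sum>i\<in>UNIV. norm (A $ i))" unfolding norm_vec_def by (rule L2_set_le_sum) simp
  also have "\<dots> \<le> (\<Sum>i\<in>UNIV. \<Sum>j\<in>UNIV. \<bar>A $ i $ j\<bar>)"
    by (intro sum_mono norm_le_l1_cart)
  finally show ?thesis .
qed

lemma bounded_matricesI:
  fixes K :: "(real ^ 'n ^ 'm) set"
  assumes "\<And>g x. g \<in> K \<Longrightarrow> norm (g *v x) \<le> r * norm x"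
  shows "bounded K"
proof -
  have "norm g \<le> (\<Sum>i\<in>(UNIV :: 'm set). \<Sum>j\<in>(UNIV :: 'n set). r)" if "g \<in> K" for g
  proof -
    have "\<bar>g $ i $ j\<bar> \<le> r" for i j
    proof -
      have "\<bar>(g *v axis j 1) $ i\<bar> \<le> norm (g *v axis j 1)" by (rule component_le_norm_cart)
      also have "\<dots> \<le> r" using assms [OF that, of "axis j 1"] by simp
      finally show ?thesis by (simp add: matrix_vector_mult_basis column_def)
    qed
    then show ?thesis by (intro order_trans [OF matrix_norm_le_sum_entries] sum_mono) auto
  qed
  then show ?thesis by (auto simp: bounded_iff)
qed

lemma bounded_isometries:
  fixes S :: "real ^ 'n ^ 'n"
  assumes "positive_definite S"
  shows "bounded {g. transpose g ** S ** g = S}"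
proof -
  obtain c where c: "c > 0" "\<And>v. c * (v \<bullet> v) \<le> (S *v v) \<bullet> v"
    using positive_definite_lower [OF assms] by blast
  obtain K where K: "K > 0" "\<And>v. \<bar>(S *v v) \<bullet> v\<bar> \<le> K * (v \<bullet> v)"
    using quadratic_form_upper by blast
  show ?thesis
  proof (rule bounded_matricesI)
    fix g x assume "g \<in> {g. transpose g ** S ** g = S}"
    then have "(S *v (g *v x)) \<bullet> (g *v x) = (S *v x) \<bullet> x"
      using form_eq [of S g x g x] by (simp add: form_def)
    then have "c * (norm (g *v x))\<^sup>2 \<le> K * (norm x)\<^sup>2"
      using c(2) [of "g *v x"] K(2) [of x] by (simp add: power2_norm_eq_inner)
    then have "(norm (g *v x))\<^sup>2 \<le> (sqrt (K / c) * norm x)\<^sup>2"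
      using c(1) K(1) by (simp add: field_simps)
    then show "norm (g *v x) \<le> sqrt (K / c) * norm x"
      by (rule power2_le_imp_le) (use c(1) K(1) in simp)
  qed
qed

text \<open>Write \<open>s(x, y)\<close> for the form and \<open>p\<close> for the product of the adjoint of \<open>g\<close> with \<open>g\<close>. Then
  \<open>s(g x, g x)\<^sup>2 = s(p x, x)\<^sup>2 \<le> s(p x, p x) s(x, x)\<close> by the Cauchy--Schwarz inequality. So if
  \<open>s(g x, g x) \<le> R s(x, x)\<close> holds for all \<open>g\<close> in \<open>K\<close>, it also holds with the square root of \<open>R\<close> in place
  of \<open>R\<close>, and the least such \<open>R \<ge> 1\<close> must be \<open>1\<close>.\<close>

lemma bounded_selfadjoint_contraction:
  fixes S :: "real ^ 'n ^ 'n" and K :: "(real ^ 'n ^ 'n) set"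
  assumes sym: "transpose S = S" and pos: "positive_definite S" and bdd: "bounded K"
    and adj: "\<And>g. g \<in> K \<Longrightarrow> \<exists>p\<in>K. transpose g ** S ** g = S ** p"
    and g: "g \<in> K"
  shows "(S *v (g *v x)) \<bullet> (g *v x) \<le> (S *v x) \<bullet> x"
proof -
  define s where "s x = (S *v x) \<bullet> x" for x
  have s0: "s 0 = 0" and s_pos: "x \<noteq> 0 \<Longrightarrow> s x > 0" and s_nonneg: "s x \<ge> 0" for x
    using pos by (cases "x = 0"; auto simp: s_def positive_definite_def intro: less_imp_le)+
  define T where "T = {R. 1 \<le> R \<and> (\<forall>g\<in>K. \<forall>x. s (g *v x) \<le> R * s x)}"
  obtain c where c: "c > 0" "\<And>v. c * (v \<bullet> v) \<le> s v"
    using positive_definite_lower [OF pos] unfolding s_def by blast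
  obtain k where k: "k > 0" "\<And>v. \<bar>s v\<bar> \<le> k * (v \<bullet> v)"
    using quadratic_form_upper [of S] unfolding s_def by blast
  obtain b where b: "b > 0" "\<And>g. g \<in> K \<Longrightarrow> norm g \<le> b"
    using bdd by (auto simp: bounded_pos)
  obtain m where m: "m > 0" "\<And>(g :: real ^ 'n ^ 'n) (x :: real ^ 'n). norm (g *v x) \<le> norm g * norm x * m"
  proof -
    have "bilinear ((*v) :: real ^ 'n ^ 'n \<Rightarrow> real ^ 'n \<Rightarrow> real ^ 'n)"
      by (simp add: bilinear_def linear_iff matrix_vector_mult_add_rdistrib matrix_vector_right_distrib
          scaleR_matrix_vector_assoc [symmetric] matrix_vector_mult_scaleR)
    then have "bounded_bilinear ((*v) :: real ^ 'n ^ 'n \<Rightarrow> real ^ 'n \<Rightarrow> real ^ 'n)"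
      by (simp add: bilinear_conv_bounded_bilinear)
    then show ?thesis using bounded_bilinear.pos_bounded that by blast
  qed
  have "s (g *v x) \<le> (k * (b * m)\<^sup>2 / c) * s x" if "g \<in> K" for g x
  proof -
    have "norm (g *v x) \<le> norm g * norm x * m" by (rule m)
    also have "\<dots> \<le> b * norm x * m" using b(2) [OF that] m(1) by (intro mult_right_mono) auto
    finally have "(norm (g *v x))\<^sup>2 \<le> (b * norm x * m)\<^sup>2" by (intro power_mono) auto
    then have "k * ((g *v x) \<bullet> (g *v x)) \<le> k * (b * norm x * m)\<^sup>2"
      using k(1) by (intro mult_left_mono) (auto simp: power2_norm_eq_inner)
    then have "s (g *v x) \<le> k * (b * norm x * m)\<^sup>2"
      using k(2) [of "g *v x"] by linarith
    also have "\<dots> = (k * (b * m)\<^sup>2 / c) * (c * (x \<bullet> x))"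
      using c(1) by (simp add: power_mult_distrib power2_norm_eq_inner)
    also have "\<dots> \<le> (k * (b * m)\<^sup>2 / c) * s x"
      using c k by (intro mult_left_mono) auto
    finally show ?thesis .
  qed
  then have "s (g *v x) \<le> max 1 (k * (b * m)\<^sup>2 / c) * s x" if "g \<in> K" for g x
    using that s_nonneg [of x] by (meson max.cobounded2 mult_right_mono order_trans)
  then have "max 1 (k * (b * m)\<^sup>2 / c) \<in> T" by (simp add: T_def)
  then have T: "T \<noteq> {}" "bdd_below T"
    by (auto simp only: empty_iff T_def intro!: bdd_belowI [of _ 1])
  define R where "R = Inf T"
  have R1: "1 \<le> R" unfolding R_def using T(1) by (intro cInf_greatest) (auto simp: T_def)
  have bound: "s (g *v x) \<le> R * s x" if "g \<in> K" for g x
  proof (cases "x = 0")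
    case False
    have "s (g *v x) / s x \<le> R" unfolding R_def
      using T(1) that s_pos [OF False] by (intro cInf_greatest) (auto simp: T_def field_simps)
    then show ?thesis using s_pos [OF False] by (simp add: field_simps)
  qed (simp add: s0)
  have "s (g *v x) \<le> sqrt R * s x" if g: "g \<in> K" for g x
  proof -
    obtain p where p: "p \<in> K" "transpose g ** S ** g = S ** p" using adj [OF g] by blast
    have "s (g *v x) = (S *v (p *v x)) \<bullet> x"
      using form_eq [of S g x g x] by (simp add: s_def form_def p(2) matrix_vector_mul_assoc)
    then have "(s (g *v x))\<^sup>2 \<le> s (p *v x) * s x"
      using symmetric_form_Cauchy_Schwarz [OF sym pos] by (simp add: s_def)
    also have "\<dots> \<le> (R * s x) * s x" by (intro mult_right_mono bound p(1) s_nonneg)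
    also have "\<dots> = (sqrt R * s x)\<^sup>2" using R1 by (simp add: power_mult_distrib power2_eq_square)
    finally show ?thesis by (rule power2_le_imp_le) (use R1 s_nonneg in simp)
  qed
  then have "sqrt R \<in> T" using R1 by (simp add: T_def)
  then have "R \<le> sqrt R" unfolding R_def using T(2) by (intro cInf_lower)
  then have "R\<^sup>2 \<le> R" using R1 by (metis order_trans power_mono real_sqrt_pow2 zero_le_one)
  then have "R \<le> 1" using R1 by (simp add: power2_eq_square)
  with R1 have "R = 1" by simp
  with bound [OF g, of x] show ?thesis by (simp add: s_def)
qed

definition centralizer :: "real ^ 'n ^ 'n \<Rightarrow> real ^ ('n::finite + 'n) ^ ('n + 'n) \<Rightarrow> (real ^ ('n + 'n) ^ ('n + 'n)) set" where
  "centralizer J I = {g \<in> carrier (U_group J). g ** I = I ** g}"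

lemma pairing_formal_inverse: "pairing ** formal_inverse g = transpose g ** pairing"
  by (simp add: formal_inverse_eq matrix_cancel [OF pairing_pairing] matrix_mul_assoc [symmetric])

lemma structure_metric_symmetric:
  fixes J :: "real ^ 'n ^ 'n"
  assumes "I \<in> structures J e"
  shows "transpose (structure_metric J I) = structure_metric J I"
proof -
  have I: "formal_inverse I = - I" "I ** product_structure J = product_structure J ** I"
    using assms by (simp_all add: structures_def end_real_commutes)
  have JJ: "formal_inverse (product_structure J) = - product_structure J"
    by (simp add: product_structure_def formal_inverse_block block_minus block_eq_iff transpose_zero
        dual_structure_def transpose_minus)
  have tr: "transpose h = - (pairing ** h ** pairing)" if "formal_inverse h = - h"
    for h :: "real ^ ('n + 'n) ^ ('n + 'n)"
  proof -
    have "transpose h ** pairing ** pairing = - (pairing ** h) ** pairing"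
      using pairing_formal_inverse [of h] that by (simp add: matrix_minus_right)
    then show ?thesis
      by (simp add: matrix_mul_assoc [symmetric] pairing_pairing matrix_minus_left)
  qed
  show ?thesis
    unfolding structure_metric_def
    by (simp add: matrix_transpose_mul transpose_pairing tr [OF I(1)] tr [OF JJ] matrix_ring
        pairing_pairing matrix_cancel [OF pairing_pairing] I(2))
qed

text \<open>Moving \<open>g\<close> across the pairing turns its transpose into its inverse, and the inverse commutes with the
  complex structure of \<open>A \<times> \<hat>A\<close>.\<close>

lemma structure_metric_pullback:
  assumes "g \<in> carrier (U_group J)"
  shows "transpose g ** structure_metric J I ** g = pairing ** product_structure J ** (formal_inverse g ** I ** g)"
proof -
  have "formal_inverse g \<in> end_real J"
    using assms by (simp add: U_group_simps end_real_formal_inverse)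
  then have "formal_inverse g ** product_structure J = product_structure J ** formal_inverse g"
    by (rule end_real_commutes)
  moreover have "transpose g ** structure_metric J I ** g
      = pairing ** (formal_inverse g ** product_structure J) ** I ** g"
    by (simp add: structure_metric_def matrix_mul_assoc pairing_formal_inverse)
  ultimately show ?thesis by (simp add: matrix_mul_assoc)
qed

context
  fixes J :: "real ^ 'n ^ 'n"
  assumes J: "complex_structure J"
begin

lemma product_structure_square: "product_structure J ** product_structure J = - mat 1"
proof -
  have JJ: "J ** J = - mat 1" using J by (simp add: complex_structure_def)
  then have "transpose J ** transpose J = - mat 1"
    by (simp add: matrix_transpose_mul [symmetric] transpose_minus)
  with JJ show ?thesis
    by (simp add: product_structure_def block_mult mat_one_block block_minus dual_structure_def matrix_ring)
qed

text \<open>The pullback of the metric by \<open>g\<close> is the metric of \<open>g\<^sup>-\<^sup>1 I g\<close>, and the metric determines the operator.\<close>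

lemma isometry_iff_commutes:
  assumes g: "g \<in> carrier (U_group J)"
  shows "transpose g ** structure_metric J I ** g = structure_metric J I \<longleftrightarrow> g ** I = I ** g"
proof -
  note gg = U_group_inverse [OF g]
  have inj: "pairing ** product_structure J ** A = pairing ** product_structure J ** B \<longleftrightarrow> A = B"
    for A B :: "real ^ ('n + 'n) ^ ('n + 'n)"
  proof
    assume "pairing ** product_structure J ** A = pairing ** product_structure J ** B"
    then have "(- product_structure J) ** (pairing ** (pairing ** product_structure J ** A))
        = (- product_structure J) ** (pairing ** (pairing ** product_structure J ** B))" by simp
    moreover have "(- product_structure J) ** (pairing ** (pairing ** product_structure J ** C)) = C"
      for C :: "real ^ ('n + 'n) ^ ('n + 'n)"
    proof -
      have "(- product_structure J) ** (pairing ** (pairing ** product_structure J ** C))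
          = - (product_structure J ** product_structure J) ** C"
        by (simp add: matrix_ring matrix_cancel [OF pairing_pairing])
      then show ?thesis by (simp add: product_structure_square)
    qed
    ultimately show "A = B" by simp
  qed simp
  have "transpose g ** structure_metric J I ** g = structure_metric J I \<longleftrightarrow> formal_inverse g ** I ** g = I"
    unfolding structure_metric_pullback [OF g] unfolding structure_metric_def by (rule inj)
  also have "\<dots> \<longleftrightarrow> g ** I = I ** g"
    by (metis gg matrix_mul_assoc matrix_mul_lid)
  finally show ?thesis .
qed

lemma centralizer_isometries:
  "g \<in> centralizer J I \<longleftrightarrow> g \<in> carrier (U_group J)
    \<and> transpose g ** structure_metric J I ** g = structure_metric J I"
  using isometry_iff_commutes by (auto simp: centralizer_def)

text \<open>A definite multiple \<open>e S\<close> forces \<open>e \<noteq> 0\<close>.\<close>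

lemma isometry_scaleR_iff:
  assumes "positive_definite (e *\<^sub>R S)"
  shows "transpose g ** (e *\<^sub>R S) ** g = e *\<^sub>R S \<longleftrightarrow> transpose g ** S ** g = S"
proof -
  have "e \<noteq> 0"
  proof
    assume "e = 0"
    then have "(0 :: real) < 0"
      using assms [unfolded positive_definite_def, THEN spec, of "axis undefined 1"] by simp
    then show False by simp
  qed
  then show ?thesis by (simp add: matrix_scaleR_left matrix_scaleR_right)
qed

text \<open>The centralizer is closed, and it is bounded because its elements preserve a definite form.\<close>

lemma compact_centralizer:
  assumes I: "I \<in> structures J e"
  shows "compact (centralizer J I)"
proof -
  have pos: "positive_definite (e *\<^sub>R structure_metric J I)" using I by (simp add: structures_def)
  have "centralizer J I \<subseteq> {g. transpose g ** (e *\<^sub>R structure_metric J I) ** g = e *\<^sub>R structure_metric J I}"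
    by (auto simp: centralizer_isometries isometry_scaleR_iff [OF pos])
  then have "bounded (centralizer J I)"
    using bounded_isometries [OF pos] bounded_subset by blast
  moreover have "closed (centralizer J I)"
  proof -
    note cont = bounded_bilinear.continuous_on [OF bounded_bilinear_matrix_mult]
    have "linear (formal_inverse :: real ^ ('n + 'n) ^ ('n + 'n) \<Rightarrow> _)"
      by (intro linearI) (simp_all add: formal_inverse_eq transpose_ring matrix_ring
          matrix_scaleR_left matrix_scaleR_right)
    then have fi: "continuous_on UNIV (formal_inverse :: real ^ ('n + 'n) ^ ('n + 'n) \<Rightarrow> _)"
      by (simp add: linear_continuous_on linear_conv_bounded_linear)
    have "centralizer J I = end_real J \<inter> {g. formal_inverse g ** g = mat 1} \<inter> {g. g ** I = I ** g}"
      by (auto simp: centralizer_def in_U_group_iff)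
    moreover have "closed \<dots>"
      by (intro closed_Int closed_end_real closed_Collect_eq cont fi continuous_on_id continuous_on_const)
    ultimately show ?thesis by simp
  qed
  ultimately show ?thesis by (simp add: compact_eq_bounded_closed)
qed

text \<open>The adjoint of \<open>g\<close> for the metric is \<open>I\<^sup>-\<^sup>1 g\<^sup>-\<^sup>1 I\<close>. As \<open>I\<close> lies in its own centralizer, a compact
  subgroup \<open>K\<close> above the centralizer is closed under adjoints. Hence the elements of \<open>K\<close> and their
  inverses are contractions, so they are isometries, and these are the elements of the centralizer.\<close>

lemma centralizer_maximal:
  assumes I: "I \<in> structures J e" and K: "subgroup K (U_group J)" "compact K"
    and sub: "centralizer J I \<subseteq> K"
  shows "K = centralizer J I"
proof (rule antisym [OF _ sub], rule subsetI)
  let ?S = "e *\<^sub>R structure_metric J I"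
  have pos: "positive_definite ?S" using I by (simp add: structures_def)
  have sym: "transpose ?S = ?S"
    by (simp add: structure_metric_symmetric [OF I] transpose_scalar)
  have Iend: "I \<in> end_real J" and II: "I ** I = - mat 1" and Ifi: "formal_inverse I = - I"
    using I by (simp_all add: structures_def)
  then have IU: "I \<in> carrier (U_group J)" by (simp add: in_U_group_iff matrix_ring)
  then have "I \<in> centralizer J I" by (simp add: centralizer_def)
  then have IK: "I \<in> K" using sub by blast
  have carr: "g \<in> carrier (U_group J)" if "g \<in> K" for g
    using subgroup.mem_carrier [OF K(1) that] .
  have mult: "g ** h \<in> K" if "g \<in> K" "h \<in> K" for g h
    using subgroup.m_closed [OF K(1) that] by (simp add: U_group_simps(2))
  have inv: "formal_inverse g \<in> K" if "g \<in> K" for g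
    using subgroup.m_inv_closed [OF K(1) that] U_group_inv [OF carr [OF that]] by simp
  have adj: "\<exists>p\<in>K. transpose g ** ?S ** g = ?S ** p" if g: "g \<in> K" for g
  proof
    let ?p = "formal_inverse I ** formal_inverse g ** I ** g"
    show "?p \<in> K" by (intro mult inv IK g)
    have "I ** ?p = formal_inverse g ** I ** g"
      by (simp add: matrix_mul_assoc U_group_inverse [OF IU])
    then have "structure_metric J I ** ?p = transpose g ** structure_metric J I ** g"
      unfolding structure_metric_pullback [OF carr [OF g]] by (simp add: structure_metric_def matrix_mul_assoc [symmetric])
    then show "transpose g ** ?S ** g = ?S ** ?p" by (simp add: matrix_scaleR_left matrix_scaleR_right)
  qed
  note contraction = bounded_selfadjoint_contraction [OF sym pos compact_imp_bounded [OF K(2)] adj]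
  fix g assume g: "g \<in> K"
  have eq: "((transpose g ** ?S ** g) *v x) \<bullet> x = (?S *v x) \<bullet> x" for x
  proof -
    have "formal_inverse g *v (g *v x) = x"
      by (simp add: matrix_vector_mul_assoc U_group_inverse [OF carr [OF g]])
    then have "(?S *v (g *v x)) \<bullet> (g *v x) = (?S *v x) \<bullet> x"
      using contraction [OF _ g, of x] contraction [OF _ inv [OF g], of "g *v x"] by simp
    then show ?thesis using form_eq [of ?S g x g x] by (simp add: form_def)
  qed
  have "transpose (transpose g ** ?S ** g) = transpose g ** ?S ** g"
    by (simp only: matrix_transpose_mul transpose_transpose sym matrix_mul_assoc)
  then have "transpose g ** ?S ** g = ?S" by (rule symmetric_matrix_eqI [OF _ sym eq])
  then show "g \<in> centralizer J I"
    using carr [OF g] by (simp add: centralizer_isometries isometry_scaleR_iff [OF pos])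
qed

end

section \<open>Transitivity\<close>

context
  fixes J :: "real ^ 'n ^ 'n"
  assumes av: "abelian_variety J"
begin

lemma ample_cone_D:
  assumes "N \<in> ample_cone J"
  shows "N \<in> NS_real J" "positive_definite (hermitian J N)"
  using assms ample_cone_iff [OF abelian_variety_complex_structure [OF av] abelian_variety_ample [OF av]] by auto

text \<open>With \<open>t = 1 - N\<^sub>0\<^sup>-\<^sup>1 N\<close> the equation \<open>N = N\<^sub>0 (1 - y)\<^sup>2\<close> becomes \<open>y = (t + y\<^sup>2) / 2\<close>, which has a
  solution by Banach's fixed point theorem when \<open>t\<close> is small. The iteration stays among the \<open>y\<close>
  with \<open>N\<^sub>0 y\<close> in \<open>NS \<otimes> \<real>\<close>; for these \<open>y\<^sup>t N\<^sub>0 = N\<^sub>0 y\<close>, so \<open>a = 1 - y\<close> satisfies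
  \<open>a\<^sup>t N\<^sub>0 a = N\<^sub>0 a\<^sup>2\<close>.\<close>

lemma NS_real_square_root:
  assumes N0: "N0 \<in> NS_real J" and N0P: "N0 ** P = mat 1"
  obtains d where "d > 0" "\<And>N. N \<in> NS_real J \<Longrightarrow> norm (N0 - N) < d
    \<Longrightarrow> \<exists>a\<in>hom_real J J. N = transpose a ** N0 ** a"
proof -
  note NS = NS_realD [OF av]
  have PN0: "P ** N0 = mat 1" using N0P by (simp add: matrix_left_right_inverse)
  have P: "P \<in> hom_real (dual_structure J) J" by (rule hom_real_inverse_to_dual [OF av NS(1) [OF N0] N0P])
  obtain K where K: "K > 0" "\<And>(A :: real ^ 'n ^ 'n) (B :: real ^ 'n ^ 'n). norm (A ** B) \<le> norm A * norm B * K"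
    using bounded_bilinear.pos_bounded [OF bounded_bilinear_matrix_mult] by blast
  \<comment> \<open>On the ball of radius \<open>r\<close> squaring has Lipschitz constant \<open>2 K r = 1\<close>, so the iteration contracts by
    \<open>1 / 2\<close>; the bound \<open>d\<close> below ensures that \<open>t\<close> lies in this ball.\<close>
  define r where "r = 1 / (2 * K)"
  have r: "r > 0" "K * r = 1 / 2" using K(1) by (simp_all add: r_def)
  define d where "d = r / (K * (norm P + 1))"
  have d: "d > 0" unfolding d_def using r(1) K(1) by (intro divide_pos_pos mult_pos_pos) (auto intro: add_nonneg_pos)
  have "\<exists>a\<in>hom_real J J. N = transpose a ** N0 ** a"
    if N: "N \<in> NS_real J" and near: "norm (N0 - N) < d" for N
  proof -
    define t where "t = P ** (N0 - N)"
    have "norm t \<le> norm P * norm (N0 - N) * K" unfolding t_def by (rule K(2))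
    also have "\<dots> \<le> (norm P + 1) * d * K"
      using near K(1) d by (intro mult_right_mono mult_mono) auto
    also have "\<dots> = r"
    proof -
      have "norm P + 1 \<noteq> 0" using norm_ge_zero [of P] by linarith
      then show ?thesis using K(1) by (simp add: d_def)
    qed
    finally have t: "norm t \<le> r" .
    define T where "T = {y. N0 ** y \<in> NS_real J} \<inter> cball 0 r"
    define f where "f y = (1 / 2) *\<^sub>R (t + y ** y)" for y
    have T_hom: "y \<in> hom_real J J" if "N0 ** y \<in> NS_real J" for y
    proof -
      have "P ** (N0 ** y) \<in> hom_real J J" using P NS(1) [OF that] by (rule hom_real_mult)
      then show ?thesis by (simp add: matrix_cancel [OF PN0])
    qed
    have T_sym: "transpose y ** N0 = N0 ** y" if "N0 ** y \<in> NS_real J" for y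
      using NS(2) [OF that] by (simp add: matrix_transpose_mul NS(2) [OF N0] matrix_minus_right)
    have "subspace {y. N0 ** y \<in> NS_real J}"
      unfolding subspace_def
      by (auto simp: matrix_zero_right matrix_add_ldistrib matrix_scaleR_right
          intro: subspace_0 [OF subspace_NS_real] subspace_add [OF subspace_NS_real]
            subspace_mul [OF subspace_NS_real])
    then have "complete T"
      unfolding T_def by (intro complete_eq_closed [THEN iffD2] closed_Int closed_subspace closed_cball)
    moreover have "0 \<in> T"
      using r(1) by (simp add: T_def matrix_zero_right subspace_0 [OF subspace_NS_real])
    moreover have "f y \<in> T" if "y \<in> T" for y
    proof -
      have y: "N0 ** y \<in> NS_real J" "norm y \<le> r" using that by (auto simp: T_def)
      have "N0 ** y ** y \<in> NS_real J"
        unfolding NS_real_iff [OF abelian_variety_complex_structure [OF av]]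
      proof
        show "N0 ** y ** y \<in> hom_real J (dual_structure J)"
          by (intro hom_real_mult [OF NS(1) [OF y(1)]] T_hom y(1))
        show "transpose (N0 ** y ** y) = - (N0 ** y ** y)"
          by (simp add: matrix_transpose_mul [of "N0 ** y"] NS(2) [OF y(1)] matrix_minus_right
              matrix_mul_assoc T_sym [OF y(1)])
      qed
      moreover have "N0 ** f y = (1 / 2) *\<^sub>R ((N0 - N) + N0 ** y ** y)"
        by (simp add: f_def t_def matrix_scaleR_right matrix_add_ldistrib matrix_mul_assoc N0P)
      ultimately have "N0 ** f y \<in> NS_real J"
        using N0 N by (simp add: subspace_mul [OF subspace_NS_real] subspace_add [OF subspace_NS_real]
            subspace_diff [OF subspace_NS_real])
      moreover have "norm (f y) \<le> r"
      proof -
        have "norm (y ** y) \<le> norm y * norm y * K" by (rule K(2))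
        also have "\<dots> \<le> r * r * K" using y(2) r(1) K(1) by (intro mult_right_mono mult_mono) auto
        also have "\<dots> = r / 2" using r(2) by (simp add: mult_ac)
        finally have "norm (t + y ** y) \<le> r + r / 2" using t by (intro norm_triangle_le) simp
        then show ?thesis using r(1) by (simp add: f_def)
      qed
      ultimately show ?thesis by (simp add: T_def)
    qed
    moreover have "dist (f y) (f z) \<le> 1 / 2 * dist y z" if "y \<in> T" "z \<in> T" for y z
    proof -
      have yz: "norm y \<le> r" "norm z \<le> r" using that by (auto simp: T_def)
      have "f y - f z = (1 / 2) *\<^sub>R (y ** (y - z) + (y - z) ** z)"
        by (simp add: f_def matrix_ring flip: scaleR_diff_right)
      then have "dist (f y) (f z) = 1 / 2 * norm (y ** (y - z) + (y - z) ** z)"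
        by (simp add: dist_norm)
      also have "\<dots> \<le> 1 / 2 * (r * norm (y - z) * K + norm (y - z) * r * K)"
        using yz r(1) K(1)
        by (intro mult_left_mono norm_triangle_mono order_trans [OF K(2)] mult_right_mono mult_mono) auto
      also have "\<dots> = (K * r) * norm (y - z)" by (simp add: mult_ac)
      finally show ?thesis by (simp add: r(2) dist_norm)
    qed
    ultimately have "\<exists>!y\<in>T. f y = y" by (intro Banach_fix [where c = "1 / 2"]) auto
    then obtain y where "y \<in> T" "f y = y" by blast
    then have y: "N0 ** y \<in> NS_real J" "t + y ** y = 2 *\<^sub>R y"
      by (auto simp: T_def f_def scaleR_2 dest: arg_cong [of _ y "\<lambda>x. 2 *\<^sub>R x"])
    define a where "a = mat 1 - y"
    have "a \<in> hom_real J J"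
      unfolding a_def by (intro hom_real_ops(2) hom_real_one T_hom y(1))
    moreover have "N = transpose a ** N0 ** a"
    proof -
      have "transpose a ** N0 = N0 ** a"
        by (simp add: a_def transpose_diff matrix_diff_rdistrib matrix_diff_ldistrib T_sym [OF y(1)])
      then have "transpose a ** N0 ** a = N0 ** (a ** a)" by (simp add: matrix_mul_assoc)
      also have "a ** a = mat 1 - t"
      proof -
        have "a ** a = mat 1 - (2 *\<^sub>R y - y ** y)"
          by (simp add: a_def matrix_diff_ldistrib matrix_diff_rdistrib scaleR_2)
        also have "2 *\<^sub>R y - y ** y = t" unfolding y(2) [symmetric] by simp
        finally show ?thesis .
      qed
      also have "N0 ** (mat 1 - t) = N"
        by (simp add: t_def matrix_diff_ldistrib matrix_mul_assoc N0P)
      finally show ?thesis by simp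
    qed
    ultimately show ?thesis by blast
  qed
  with d show ?thesis using that by blast
qed

text \<open>The ample cone is convex, hence connected, and by \<open>NS_real_square_root\<close> the congruence classes are
  open in it.\<close>

lemma ample_cone_congruent:
  assumes "N \<in> ample_cone J" "N' \<in> ample_cone J"
  shows "\<exists>a\<in>hom_real J J. N' = transpose a ** N ** a"
proof -
  let ?R = "\<lambda>N N'. \<exists>a\<in>hom_real J J. N' = transpose a ** N ** a"
  have inv: "\<exists>P. X ** P = mat 1" if "X \<in> ample_cone J" for X
    using positive_definite_inverse ample_cone_D(2) [OF that] unfolding hermitian_def by metis
  show ?thesis
  proof (rule connected_equivalence_relation [where R = ?R and S = "ample_cone J"])
    have "convex (ample_cone J)"
    proof (rule convexI)
      fix X Y and u v :: real
      assume XY: "X \<in> ample_cone J" "Y \<in> ample_cone J" and uv: "0 \<le> u" "0 \<le> v" "u + v = 1"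
      then consider "u = 0" "v = 1" | "u = 1" "v = 0" | "u > 0" "v > 0" by force
      then show "u *\<^sub>R X + v *\<^sub>R Y \<in> ample_cone J"
        using XY by cases (auto intro: ample_cone_add ample_cone_scaleR)
    qed
    then show "connected (ample_cone J)" by (rule convex_connected)
    show "?R Y X" if XY: "?R X Y" "X \<in> ample_cone J" "Y \<in> ample_cone J" for X Y
    proof -
      obtain a where a: "a \<in> hom_real J J" "Y = transpose a ** X ** a" using XY(1) by blast
      obtain P where "P ** Y = mat 1" using inv [OF XY(3)] matrix_left_right_inverse by blast
      then have "P ** transpose a ** X ** a = mat 1" by (simp add: a(2) matrix_mul_assoc)
      then obtain b where ba: "b ** a = mat 1" by blast
      then have ab: "a ** b = mat 1" by (simp add: matrix_left_right_inverse)
      have "transpose b ** Y ** b = transpose (a ** b) ** X ** (a ** b)"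
        by (simp add: a(2) matrix_transpose_mul matrix_mul_assoc)
      then have "X = transpose b ** Y ** b" by (simp add: ab)
      then show ?thesis using hom_real_inverse_end [OF a(1) ab] by blast
    qed
    show "?R X Z" if XYZ: "?R X Y" "?R Y Z" for X Y Z
    proof -
      obtain a b where ab: "a \<in> hom_real J J" "Y = transpose a ** X ** a"
        "b \<in> hom_real J J" "Z = transpose b ** Y ** b" using XYZ by blast
      then have "Z = transpose (a ** b) ** X ** (a ** b)"
        by (simp add: matrix_transpose_mul matrix_mul_assoc)
      then show ?thesis using hom_real_mult [OF ab(1,3)] by blast
    qed
    show "\<exists>U. openin (top_of_set (ample_cone J)) U \<and> X \<in> U \<and> (\<forall>Y\<in>U. ?R X Y)"
      if X: "X \<in> ample_cone J" for X
    proof -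
      obtain P where P: "X ** P = mat 1" using inv [OF X] by blast
      obtain d where d: "d > 0" "\<And>Y. Y \<in> NS_real J \<Longrightarrow> norm (X - Y) < d \<Longrightarrow> ?R X Y"
        using NS_real_square_root [OF ample_cone_D(1) [OF X] P] by blast
      have "openin (top_of_set (ample_cone J)) (ample_cone J \<inter> ball X d)"
        by (simp add: openin_open_Int)
      moreover have "X \<in> ample_cone J \<inter> ball X d" using X d(1) by simp
      moreover have "\<forall>Y\<in>ample_cone J \<inter> ball X d. ?R X Y"
        using d(2) ample_cone_D(1) by (auto simp: dist_norm)
      ultimately show ?thesis by blast
    qed
  qed (fact assms)+
qed

text \<open>The element \<open>g\<close> is the composition of the translation by \<open>- M1\<close>, the block diagonal element
  \<open>diag(a\<^sup>-\<^sup>1, a\<^sup>t)\<close>, which acts by \<open>\<omega> \<mapsto> a\<^sup>t \<omega> a\<close>, and the translation by \<open>M2\<close>.\<close>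

lemma half_space_transitive:
  assumes w: "complex_mat M1 N1 \<in> half_space J e" "complex_mat M2 N2 \<in> half_space J e"
    and a: "a \<in> hom_real J J" "N2 = transpose a ** N1 ** a"
  shows "\<exists>g\<in>carrier (U_group J). act g (complex_mat M1 N1) = complex_mat M2 N2"
proof -
  note NS = NS_realD [OF av]
  have M1: "M1 \<in> NS_real J"
    using half_space_cases [OF w(1)] by (metis complex_mat_parts(1))
  have M2: "M2 \<in> NS_real J" and "\<exists>P2. P2 ** N2 = mat 1"
    using half_space_cases [OF w(2)] by (metis complex_mat_parts(1), metis complex_mat_parts(2))
  then obtain P2 where "P2 ** transpose a ** N1 ** a = mat 1"
    by (auto simp: a(2) matrix_mul_assoc)
  then obtain b where ba: "b ** a = mat 1" by blast
  then have ab: "a ** b = mat 1" by (simp add: matrix_left_right_inverse)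
  have b: "b \<in> hom_real J J" by (rule hom_real_inverse_end [OF a(1) ab])
  have tba: "transpose a ** transpose b = mat 1"
    by (simp add: matrix_transpose_mul [symmetric] ba)
  have tab: "transpose b ** transpose a = mat 1"
    by (simp add: matrix_transpose_mul [symmetric] ab)
  define c where "c = M2 ** b - transpose a ** M1"
  define g where "g = block b 0 c (transpose a)"
  have "g \<in> end_real J"
    unfolding g_def block_in_end_real c_def
    using b hom_real_transpose [OF a(1)] NS(1) [OF M1] NS(1) [OF M2]
    by (auto intro!: hom_real_ops(2,5) intro: hom_real_mult)
  moreover have "formal_inverse g ** g = mat 1"
    by (simp add: g_def formal_inverse_block block_mult mat_one_block block_eq_iff
        c_def transpose_ring matrix_ring NS(2) [OF M1] NS(2) [OF M2] ab tab ba matrix_cancel [OF ab]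
        matrix_cancel [OF tab])
  ultimately have g: "g \<in> carrier (U_group J)" by (simp add: in_U_group_iff)
  have "cmat b ** cmat a = mat 1" "cmat a ** cmat b = mat 1"
    by (simp_all add: cmat_ring(4) [symmetric] ab ba cmat_ring(6))
  then have inv: "matrix_inv (act_denom g (complex_mat M1 N1)) = cmat a"
    by (intro matrix_inv_eq) (simp_all add: act_denom_def g_def cmat_ring matrix_zero_left)
  have "act g (complex_mat M1 N1)
      = cmat (c ** a + transpose a ** M1 ** a) + mat \<i> ** cmat (transpose a ** N1 ** a)"
  proof -
    have "cmat (transpose a) ** (mat \<i> ** cmat N1) = mat \<i> ** (cmat (transpose a) ** cmat N1)"
      by (simp only: matrix_mul_assoc mat_scalar_commute)
    then show ?thesis
      unfolding act_def inv by (simp add: g_def complex_mat_eq cmat_ring matrix_ring)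
  qed
  moreover have "c ** a + transpose a ** M1 ** a = M2" by (simp add: c_def matrix_ring ba)
  ultimately have "act g (complex_mat M1 N1) = complex_mat M2 N2" by (simp add: a(2) complex_mat_eq)
  with g show ?thesis by blast
qed

lemma transitive_half_space:
  assumes E: "E = half_space J e"
    and cone: "\<And>w w'. w \<in> E \<Longrightarrow> w' \<in> E \<Longrightarrow> \<exists>a\<in>hom_real J J. im_mat w' = transpose a ** im_mat w ** a"
  shows "transitive_action (U_group J) E (\<lambda>g. restrict (act g) E)"
proof (intro transitive_action.intro transitive_action_axioms.intro)
  show "group_action (U_group J) E (\<lambda>g. restrict (act g) E)"
    using group_action_union [OF av, of E "{e}"] E by simp
  fix w w' assume w: "w \<in> E" "w' \<in> E"
  obtain a where a: "a \<in> hom_real J J" "im_mat w' = transpose a ** im_mat w ** a"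
    using cone [OF w] by blast
  have "\<exists>g\<in>carrier (U_group J). act g w = w'"
    using w unfolding E
    by (rule half_space_transitive [of "re_mat w" "im_mat w" e "re_mat w'" "im_mat w'" a,
          unfolded complex_mat_parts(3), OF _ _ a])
  then show "\<exists>g\<in>carrier (U_group J). restrict (act g) E w = w'" using w by simp
qed

lemma transitive_C_plus: "transitive_action (U_group J) (C_plus J) (\<lambda>g. restrict (act g) (C_plus J))"
  by (rule transitive_half_space [OF C_plus_eq [OF av]])
    (auto simp: C_plus_def intro: ample_cone_congruent)

lemma transitive_C_minus: "transitive_action (U_group J) (C_minus J) (\<lambda>g. restrict (act g) (C_minus J))"
proof (rule transitive_half_space [OF C_minus_eq [OF av]])
  fix w w' assume "w \<in> C_minus J" "w' \<in> C_minus J"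
  then obtain N N' where N: "N \<in> ample_cone J" "im_mat w = - N" "N' \<in> ample_cone J" "im_mat w' = - N'"
    by (auto simp: C_minus_def)
  obtain a where "a \<in> hom_real J J" "N' = transpose a ** N ** a"
    using ample_cone_congruent [OF N(1,3)] by blast
  then show "\<exists>a\<in>hom_real J J. im_mat w' = transpose a ** im_mat w ** a"
    by (intro bexI [of _ a]) (simp_all add: N(2,4) matrix_minus_left matrix_minus_right)
qed

lemma C_both_eq: "C_both J = (\<Union>e\<in>{1, - 1}. half_space J e)"
  by (simp add: C_both_def C_plus_eq [OF av] C_minus_eq [OF av])

lemma maximal_compact_stabilizer:
  assumes w: "w \<in> C_both J"
  shows "maximal_compact_subgroup
    (stabilizer (U_group J) (\<lambda>g. restrict (act g) (C_both J)) w) (U_group J)"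
proof -
  interpret group_action "U_group J" "C_both J" "\<lambda>g. restrict (act g) (C_both J)"
    by (rule group_action_union [OF av C_both_eq])
  obtain e where e: "w \<in> half_space J e" using w by (auto simp: C_both_eq)
  note I = structure_of_in_structures [OF av e]
  have stab: "stabilizer (U_group J) (\<lambda>g. restrict (act g) (C_both J)) w = centralizer J (structure_of w)"
    using w act_fixes_iff [OF av _ e] by (auto simp: stabilizer_def centralizer_def)
  have "subgroup (centralizer J (structure_of w)) (U_group J)"
    using stabilizer_subgroup [OF w] by (simp add: stab)
  then show ?thesis
    unfolding maximal_compact_subgroup_def compact_subgroup_def stab
    using compact_centralizer [OF abelian_variety_complex_structure [OF av] I] centralizer_maximal [OF abelian_variety_complex_structure [OF av] I] by blast
qed

end

theorem theorem8p2:
  fixes J :: "real ^ ('n::finite) ^ 'n"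
  assumes "abelian_variety J"
  shows "(\<forall>g\<in>carrier (U_group J). \<forall>\<omega>\<in>C_both J. invertible (act_denom g \<omega>))
       \<and> group_action (U_group J) (C_both J) (\<lambda>g. restrict (act g) (C_both J))
       \<and> transitive_action (U_group J) (C_plus J) (\<lambda>g. restrict (act g) (C_plus J))
       \<and> transitive_action (U_group J) (C_minus J) (\<lambda>g. restrict (act g) (C_minus J))
       \<and> (\<forall>\<omega>\<in>C_both J. maximal_compact_subgroup
            (stabilizer (U_group J) (\<lambda>g. restrict (act g) (C_both J)) \<omega>) (U_group J))"
proof (intro conjI ballI)
  show "invertible (act_denom g \<omega>)" if "g \<in> carrier (U_group J)" "\<omega> \<in> C_both J" for g \<omega>
    using that act_conjugates(1) [OF assms] by (auto simp: C_both_eq [OF assms])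
qed (fact group_action_union [OF assms C_both_eq [OF assms]]
    transitive_C_plus [OF assms] transitive_C_minus [OF assms]
  | rule maximal_compact_stabilizer [OF assms], assumption)+

end
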